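(* Let $X$ be exponentially distributed with mean $1$. For each $n$, let the weights $w_1\le\cdots\le w_n$ of a weighted voting game be $n$ independent samples of $X$ sorted in non-decreasing order, and let $\varphi_1,\varphi_n$ be the Shapley values of agents $1$ and $n$. For every $\epsilon>0$ there exist $\psi<1$ and $K>0$ such that: (1) for all $q \in [n^{-3/4},1-\epsilon]$, \[ \mathbb{E}[\varphi_n(qn\mathbb{E}[X])] = \int_0^\infty (1-e^{-x})^n \frac{x}{e^x-(1+x)}\,dx + O(\psi^{n^{1/4}}), \] and \[ \int_0^\infty (1-e^{-x})^n \frac{x}{e^x-(1+x)}\,dx = \frac{\log n + \gamma}{n} + O\Big(\frac{\log^2 n}{n^2}\Big), \] where $\gamma$ is the Euler–Mascheroni constant; (2) for all $q \in [n^{-3/4},1-Kn^{-1/3}]$, \[ \mathbb{E}[\varphi_1(qn\mathbb{E}[X])] = \int_0^\infty e^{-nx}\frac{x}{x+1}\,dx + O(\psi^{n^{1/4}}), \] and \[ \int_0^\infty e^{-nx}\frac{x}{x+1}\,dx = \frac{1}{n^2} - O\Big(\frac{1}{n^3}\Big). \]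
   Context: Shapley value of agent $i$ at quota $Q$: $\varphi_i(Q) = \Pr_{\pi}[Q - w_i \le \sum_{j \text{ precedes } i \text{ in }\pi} w_j < Q]$, with $\pi$ a uniformly random ordering of the agents. Expectations are over the random weights; implied constants do not depend on $n$ or $q$. *)

theory Defs
  imports "HOL-Probability.Probability" "HOL-Analysis.Harmonic_Numbers"
begin

text \<open>Agents are 0,...,n-1 (agent k+1 of the paper is index k).
  A permutation p permutes {..<n} maps each agent to its position in the ordering;
  agent j precedes agent i iff p j < p i.  The Shapley value is the fraction of
  the n! orderings in which agent i is pivotal.\<close>
definition shapley :: "nat \<Rightarrow> (nat \<Rightarrow> real) \<Rightarrow> nat \<Rightarrow> real \<Rightarrow> real" where
  "shapley n w i Q =
     real (card {p. p permutes {..<n} \<and>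
                   Q - w i \<le> (\<Sum>j\<in>{j. j < n \<and> p j < p i}. w j) \<and>
                   (\<Sum>j\<in>{j. j < n \<and> p j < p i}. w j) < Q}) / fact n"

definition sorted_weights :: "nat \<Rightarrow> (nat \<Rightarrow> real) \<Rightarrow> nat \<Rightarrow> real" where
  "sorted_weights n x k = sort (map x [0..<n]) ! k"

definition expX :: "real measure" where
  "expX = density lborel (exponential_density 1)"

definition sample :: "nat \<Rightarrow> (nat \<Rightarrow> real) measure" where
  "sample n = PiM {..<n} (\<lambda>_. expX)"

definition exp_shapley :: "nat \<Rightarrow> nat \<Rightarrow> real \<Rightarrow> real" where
  "exp_shapley n k Q = (\<integral>x. shapley n (sorted_weights n x) k Q \<partial>sample n)"

definition meanX :: real where
  "meanX = (\<integral>x. x \<partial>expX)"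

end

(* Given that agent i carries the extreme weight y, the other weights are independent with the law of
   an exponential variable conditioned on B = {..y} (largest agent) or B = {y<..} (smallest agent), and the
   position of i in the random ordering is uniform on {0..n-1}.  Hence E[phi_i(Q)] is the expectation over y
   of P(B)^(n-1) times the expected number W of points in [Q - y, Q) of a renewal process stopped after
   n - 1 steps.

   In both cases the step density f satisfies f + f' = (1 + d) delta_0 - d delta_y, with d = 1 / (e^y - 1),
   respectively d = -1.  It follows that W(t) = y + d * integral of W over [t - y, t], up to the probability
   that n steps do not reach Q.  Since |d| y is small, this is a contraction around the fixed point
   y / (1 - d y), with an error of order e^((y - Q) / 2); integrating the fixed point over y gives the
   integrals of the theorem.  The Chernoff bound controls the truncation error. *)
theory Submission
  imports Defs "HOL-Real_Asymp.Real_Asymp"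
begin

section \<open>Exponential smoothing of distribution functions\<close>

text \<open>No density is ever differentiated. The equation for \<open>f\<close> is used in
  integrated form: by memorylessness a restricted exponential law combines the full law with its
  shift by \<open>y\<close>, and convolution with the full law satisfies a first-order equation that
  is integrated once from 0. The obstacle is that \<open>\<bar>d\<bar> * y\<close> is not small for
  every \<open>y\<close>: for the largest agent it tends to 1 as \<open>y\<close> tends to 0, for
  the smallest it equals \<open>y\<close>. In those ranges, \<open>y\<close> below a threshold
  \<open>M\<^sub>0\<close> and \<open>y\<close> above 1/2, the crude bound W \<le> n suffices,
  because P(B)^(n-1) is exponentially small there. Conditioning also divides the n-step probability
  by P(B)^n. For the smallest agent this cancels exactly; for the largest it is paid from half of
  the Chernoff exponent, which ties \<open>M\<^sub>0\<close> to \<epsilon>. The powers of n fit as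
  follows: q \<ge> n^(-3/4) means Q \<ge> n^(1/4), so e^(-Q/2) has the required order, and a gap
  n^(-1/3) between q and 1 makes the Chernoff exponent of order n^(1/3), which exceeds
  n^(1/4).\<close>

lemma sets_expX [measurable_cong, simp]: "sets expX = sets borel"
  and space_expX [simp]: "space expX = UNIV"
  by (simp_all add: expX_def)

interpretation expX: prob_space expX
  unfolding expX_def by (rule prob_space_exponential_density) simp

lemma exponential_density_1: "exponential_density 1 s = exp (- s) * indicator {0..} s" for s :: real
  by (auto simp: exponential_density_def)

section \<open>Integration against the exponential law and its memorylessness\<close>

lemma expX_integral:
  fixes f :: "real \<Rightarrow> real"
  assumes [measurable]: "f \<in> borel_measurable borel"
  shows "(\<integral>s. f s \<partial>expX) = (LBINT s:{0<..}. exp (- s) * f s)"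
proof -
  have "(\<integral>s. f s \<partial>expX) = (\<integral>s. exponential_density 1 s *\<^sub>R f s \<partial>lborel)"
    unfolding expX_def by (rule integral_density) auto
  also have "\<dots> = (LBINT s:{0<..}. exp (- s) * f s)"
    unfolding set_lebesgue_integral_def
  proof (rule integral_cong_AE)
    show "AE s in lborel. exponential_density 1 s *\<^sub>R f s
            = indicator {0<..} s *\<^sub>R (exp (- s) * f s)"
      using AE_lborel_singleton[of "0::real"]
      by eventually_elim (auto simp: exponential_density_1 indicator_def)
  qed auto
  finally show ?thesis .
qed

lemma expX_integrable_iff:
  fixes f :: "real \<Rightarrow> real"
  assumes [measurable]: "f \<in> borel_measurable borel"
  shows "integrable expX f \<longleftrightarrow> set_integrable lborel {0<..} (\<lambda>s. exp (- s) * f s)"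
proof -
  have "integrable expX f \<longleftrightarrow> integrable lborel (\<lambda>s. exponential_density 1 s *\<^sub>R f s)"
    unfolding expX_def by (rule integrable_density) auto
  also have "\<dots> \<longleftrightarrow> set_integrable lborel {0<..} (\<lambda>s. exp (- s) * f s)"
    unfolding set_integrable_def
  proof (rule integrable_cong_AE)
    show "AE s in lborel. exponential_density 1 s *\<^sub>R f s
            = indicator {0<..} s *\<^sub>R (exp (- s) * f s)"
      using AE_lborel_singleton[of "0::real"]
      by eventually_elim (auto simp: exponential_density_1 indicator_def)
  qed auto
  finally show ?thesis .
qed

lemma AE_expX_pos: "AE s in expX. 0 < s"
proof -
  have "AE s in lborel. (0::real) < exponential_density 1 s \<longrightarrow> 0 < s"
    using AE_lborel_singleton[of "0::real"]
    by eventually_elim (auto simp: exponential_density_1 indicator_def split: if_splits)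
  then show ?thesis
    unfolding expX_def by (subst AE_density) auto
qed

lemma AE_expX_neq: "AE s in expX. s \<noteq> c"
proof -
  have "AE s in lborel. (0::real) < exponential_density 1 s \<longrightarrow> s \<noteq> c"
    using AE_lborel_singleton[of c] by eventually_elim auto
  then show ?thesis
    unfolding expX_def by (subst AE_density) auto
qed

lemma expX_integrable_bounded:
  fixes f :: "real \<Rightarrow> real"
  assumes "f \<in> borel_measurable borel" "\<And>s. \<bar>f s\<bar> \<le> B"
  shows "integrable expX f"
  by (rule expX.integrable_const_bound[where B = B]) (use assms in auto)

text \<open>Nonnegativity of \<open>f\<close> lets the nonnegative integral deliver integrability
  together with the value, so an explicit integral needs only a primitive and its limit at
  infinity.\<close>

lemma half_line_FTC:
  fixes f F :: "real \<Rightarrow> real"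
  assumes [measurable]: "f \<in> borel_measurable borel"
    and deriv: "\<And>x. 0 \<le> x \<Longrightarrow> DERIV F x :> f x"
    and nonneg: "\<And>x. 0 \<le> x \<Longrightarrow> 0 \<le> f x"
    and lim: "(F \<longlongrightarrow> T) at_top"
  shows "set_integrable lborel {0<..} f" "(LBINT x:{0<..}. f x) = T - F 0"
proof -
  have "F 0 \<le> F x" if "0 \<le> x" for x
    using that deriv nonneg by (intro DERIV_nonneg_imp_nondecreasing[of 0 x F]) auto
  then have "F 0 \<le> T"
    by (intro tendsto_lowerbound[OF lim]) (auto simp: eventually_at_top_linorder)
  have "has_bochner_integral lborel (\<lambda>x. f x * indicator {0..} x) (T - F 0)"
  proof (rule has_bochner_integral_nn_integral)
    have "(\<integral>\<^sup>+x. ennreal (f x * indicator {0..} x) \<partial>lborel)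
        = (\<integral>\<^sup>+x. ennreal (f x) * indicator {0..} x \<partial>lborel)"
      by (intro nn_integral_cong) (auto simp: indicator_def)
    also have "\<dots> = T - F 0" by (rule nn_integral_FTC_atLeast) (use assms in auto)
    finally show "(\<integral>\<^sup>+x. ennreal (f x * indicator {0..} x) \<partial>lborel) = T - F 0" .
  qed (use nonneg \<open>F 0 \<le> T\<close> in \<open>auto simp: indicator_def\<close>)
  then have "has_bochner_integral lborel (\<lambda>x. indicator {0<..} x *\<^sub>R f x) (T - F 0)"
    by (rule has_bochner_integral_cong_AE[THEN iffD1, rotated -1])
       (use AE_lborel_singleton[of "0::real"] in \<open>auto elim!: eventually_mono simp: indicator_def\<close>)
  then show "set_integrable lborel {0<..} f" "(LBINT x:{0<..}. f x) = T - F 0"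
    by (auto simp: set_integrable_def set_lebesgue_integral_def has_bochner_integral_iff)
qed

lemma expX_exp_moment:
  fixes c :: real
  assumes "c < 1"
  shows "integrable expX (\<lambda>s. exp (c * s))" "(\<integral>s. exp (c * s) \<partial>expX) = 1 / (1 - c)"
proof -
  let ?F = "\<lambda>s. - exp (- (1 - c) * s) / (1 - c)"
  have d: "DERIV ?F s :> exp (- s) * exp (c * s)" for s
  proof -
    have "DERIV (\<lambda>s. - exp (- a * s) / a) s :> exp (- a * s)" if "a \<noteq> 0" for a
      using that by (auto intro!: derivative_eq_intros)
    from this[of "1 - c"] show ?thesis
      using assms by (simp add: algebra_simps flip: exp_add)
  qed
  have "filterlim (\<lambda>s. - (1 - c) * s) at_bot at_top"
    using assms by (intro filterlim_tendsto_neg_mult_at_bot[OF tendsto_const] filterlim_ident) auto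
  then have "((\<lambda>s. exp (- (1 - c) * s)) \<longlongrightarrow> 0) at_top"
    by (rule filterlim_compose[OF exp_at_bot])
  then have "(?F \<longlongrightarrow> - 0 / (1 - c)) at_top"
    using assms by (intro tendsto_intros) auto
  note F = half_line_FTC[OF _ d _ this]
  show "integrable expX (\<lambda>s. exp (c * s))" "(\<integral>s. exp (c * s) \<partial>expX) = 1 / (1 - c)"
    using F by (auto simp: expX_integrable_iff expX_integral)
qed

text \<open>Memorylessness: an exponential variable exceeding \<open>M\<close> is distributed as
  \<open>M\<close> plus a fresh exponential variable. This is the source of the shift by
  \<open>y\<close> in the renewal recursions.\<close>

lemma expX_shift:
  fixes g :: "real \<Rightarrow> real"
  assumes [measurable]: "g \<in> borel_measurable borel" and M: "0 \<le> M"
  shows "(\<integral>s. indicator {M<..} s * g s \<partial>expX) = exp (- M) * (\<integral>s. g (M + s) \<partial>expX)"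
proof -
  have "(\<integral>s. indicator {M<..} s * g s \<partial>expX)
    = (\<integral>s. indicator {0<..} s *\<^sub>R (exp (- s) * (indicator {M<..} s * g s)) \<partial>lborel)"
    by (subst expX_integral) (auto simp: set_lebesgue_integral_def)
  also have "\<dots> = (\<integral>s. indicator {0<..} (M + s) *\<^sub>R (exp (- (M + s)) * (indicator {M<..} (M + s) * g (M + s))) \<partial>lborel)"
    by (subst lborel_integral_real_affine[where c = 1 and t = M]) auto
  also have "\<dots> = (\<integral>s. exp (- M) * (indicator {0<..} s *\<^sub>R (exp (- s) * g (M + s))) \<partial>lborel)"
    by (rule Bochner_Integration.integral_cong)
       (use M in \<open>auto simp: indicator_def exp_add exp_diff exp_minus field_simps\<close>)
  also have "\<dots> = exp (- M) * (\<integral>s. g (M + s) \<partial>expX)"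
    by (subst expX_integral) (auto simp: set_lebesgue_integral_def)
  finally show ?thesis .
qed

lemma measure_expX_greaterThan: "0 \<le> M \<Longrightarrow> measure expX {M<..} = exp (- M)"
  using expX_shift[of "\<lambda>_. 1" M] expX.prob_space by simp

lemma measure_expX_atMost: "0 \<le> M \<Longrightarrow> measure expX {..M} = 1 - exp (- M)"
  using expX.prob_compl[of "{M<..}"] measure_expX_greaterThan[of M]
  by (simp add: Compl_eq_Diff_UNIV[symmetric] greaterThan_def Compl_eq not_less atMost_def)

section \<open>Distribution functions and their convolution with the exponential law\<close>

text \<open>Continuity is asked only on the positive axis, since the law of the empty sum jumps at
  0; the value at 0 is 0 because sums are compared strictly with \<open>t\<close>. Monotonicity
  supplies measurability and integrability on intervals.\<close>

definition cdf_like :: "(real \<Rightarrow> real) \<Rightarrow> bool" where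
  "cdf_like F \<longleftrightarrow> mono F \<and> (\<forall>t. 0 \<le> F t \<and> F t \<le> 1) \<and> (\<forall>t\<le>0. F t = 0) \<and> continuous_on {0<..} F"

definition exp_smooth :: "(real \<Rightarrow> real) \<Rightarrow> real \<Rightarrow> real" where
  "exp_smooth F t = (\<integral>s. F (t - s) \<partial>expX)"

lemma cdf_likeD:
  assumes "cdf_like F"
  shows "mono F" "0 \<le> F t" "F t \<le> 1" "t \<le> 0 \<Longrightarrow> F t = 0" "continuous_on {0<..} F"
    "F \<in> borel_measurable borel"
  using assms borel_measurable_mono[of F] by (auto simp: cdf_like_def)

text \<open>Substituting \<open>r = t - s\<close>. Any \<open>a \<le> 0\<close> with
  \<open>a \<le> t\<close> may be the lower limit because \<open>F\<close> vanishes on the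
  nonpositive axis: \<open>a = 0\<close> serves the differential equation, a negative
  \<open>a\<close> serves continuity across 0.\<close>

lemma exp_smooth_eq:
  assumes F: "cdf_like F" and a: "a \<le> 0" "a \<le> t"
  shows "exp_smooth F t = exp (- t) * integral {a..t} (\<lambda>r. exp r * F r)"
proof -
  note [measurable] = cdf_likeD(6)[OF F]
  have "exp_smooth F t = (\<integral>s. indicator {0<..} s *\<^sub>R (exp (- s) * F (t - s)) \<partial>lborel)"
    unfolding exp_smooth_def by (subst expX_integral) (auto simp: set_lebesgue_integral_def)
  also have "\<dots> = (\<integral>r. indicator {0<..} (t - r) *\<^sub>R (exp (r - t) * F r) \<partial>lborel)"
    by (subst lborel_integral_real_affine[where c = "-1" and t = t]) auto
  also have "\<dots> = (\<integral>r. indicator {a..t} r *\<^sub>R (exp (r - t) * F r) \<partial>lborel)"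
  proof (rule integral_cong_AE)
    show "AE r in lborel. indicator {0<..} (t - r) *\<^sub>R (exp (r - t) * F r)
        = indicator {a..t} r *\<^sub>R (exp (r - t) * F r)"
      using AE_lborel_singleton[of t]
      by eventually_elim (use a cdf_likeD(4)[OF F] in \<open>auto simp: indicator_def\<close>)
  qed auto
  also have "\<dots> = integral {a..t} (\<lambda>r. exp (r - t) * F r)"
    unfolding set_lebesgue_integral_def[symmetric]
  proof (rule set_borel_integral_eq_integral)
    show "set_integrable lborel {a..t} (\<lambda>r. exp (r - t) * F r)"
    proof (rule set_integrable_bound)
      show "set_integrable lborel {a..t} (\<lambda>r. 1 :: real)"
        by (rule borel_integrable_atLeastAtMost') auto
      show "AE r in lborel. r \<in> {a..t} \<longrightarrow> norm (exp (r - t) * F r) \<le> norm (1::real)"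
        using cdf_likeD(2,3)[OF F] by (auto intro!: mult_le_one)
    qed (auto simp: set_borel_measurable_def)
  qed
  also have "\<dots> = integral {a..t} (\<lambda>r. exp (- t) * (exp r * F r))"
    by (simp add: exp_diff exp_minus field_simps)
  finally show ?thesis by simp
qed

lemma
  assumes F: "cdf_like F"
  shows exp_smooth_mono: "mono (exp_smooth F)"
    and exp_smooth_ge0: "0 \<le> exp_smooth F t"
    and exp_smooth_le1: "exp_smooth F t \<le> 1"
    and exp_smooth_nonpos: "t \<le> 0 \<Longrightarrow> exp_smooth F t = 0"
proof -
  note [measurable] = cdf_likeD(6)[OF F]
  have int: "integrable expX (\<lambda>s. F (t - s))" for t
    by (rule expX_integrable_bounded[where B = 1]) (use cdf_likeD(2,3)[OF F] in auto)
  show "mono (exp_smooth F)"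
    unfolding exp_smooth_def by (intro monoI integral_mono int) (auto intro: monoD[OF cdf_likeD(1)[OF F]])
  show "0 \<le> exp_smooth F t" using cdf_likeD[OF F] by (auto simp: exp_smooth_def)
  have "exp_smooth F t \<le> (\<integral>s. 1 \<partial>expX)"
    unfolding exp_smooth_def by (rule integral_mono[OF int]) (use cdf_likeD[OF F] in auto)
  then show "exp_smooth F t \<le> 1" by (simp add: expX.prob_space[simplified])
  show "exp_smooth F t = 0" if "t \<le> 0"
    unfolding exp_smooth_def
    by (rule integral_eq_zero_AE) (use AE_expX_pos in eventually_elim, use that cdf_likeD(4)[OF F] in auto)
qed

lemma integral_exp_cdf_like:
  assumes F: "cdf_like F" 
  shows "(\<lambda>r. exp r * F r) integrable_on {a..b}"
  by (rule integrable_on_mono_on) (use cdf_likeD[OF F] in \<open>auto intro!: mono_onI mult_mono dest: monoD\<close>)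

lemma integrable_cdf_like:
  assumes F: "cdf_like F" 
  shows "F integrable_on {a..b}"
  by (rule integrable_on_mono_on) (use cdf_likeD[OF F] in \<open>auto intro!: mono_onI dest: monoD\<close>)

lemma exp_smooth_continuous:
  assumes F: "cdf_like F"
  shows "continuous_on UNIV (exp_smooth F)"
proof -
  have "isCont (exp_smooth F) t" for t
  proof -
    define R where "R = \<bar>t\<bar> + 1"
    have "continuous_on {-R..R} (\<lambda>t. exp (- t) * integral {-R..t} (\<lambda>r. exp r * F r))"
      by (intro continuous_intros indefinite_integral_continuous_1 integral_exp_cdf_like F)
    then have "continuous_on {-R..R} (exp_smooth F)"
      by (rule continuous_on_eq) (auto simp: R_def intro!: exp_smooth_eq[OF F, symmetric])
    then have "continuous_on {-R<..<R} (exp_smooth F)" by (rule continuous_on_subset) auto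
    moreover have "t \<in> {-R<..<R}" by (auto simp: R_def)
    ultimately show ?thesis by (simp add: continuous_on_eq_continuous_at)
  qed
  then show ?thesis by (simp add: continuous_on_eq_continuous_at)
qed

lemma exp_smooth_cdf_like: "cdf_like F \<Longrightarrow> cdf_like (exp_smooth F)"
  unfolding cdf_like_def[of "exp_smooth F"]
  using exp_smooth_mono exp_smooth_ge0 exp_smooth_le1 exp_smooth_nonpos
  by (auto intro: continuous_on_subset[OF exp_smooth_continuous])

text \<open>For S = \<open>exp_smooth F\<close> the factor \<open>exp (- t)\<close> gives S' = F - S
  on the positive axis, with S(0) = 0. The equation is kept in integrated form because it fails at a
  jump of \<open>F\<close>, such as the one at 0, which the shift by \<open>y\<close> moves into the
  positive axis.\<close>

lemma exp_smooth_primitive: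
  assumes F: "cdf_like F" 
  shows "exp_smooth F t + integral {0..t} (exp_smooth F) = integral {0..t} F"
proof (cases "0 \<le> t")
  case t: True
  let ?E = "\<lambda>t. integral {0..t} (\<lambda>r. exp r * F r)"
  have eq: "exp_smooth F r = exp (- r) * ?E r" if "0 \<le> r" for r
    using that by (intro exp_smooth_eq F) auto
  have "((\<lambda>r. F r - exp_smooth F r) has_integral (exp_smooth F t - exp_smooth F 0)) {0..t}"
  proof (rule fundamental_theorem_of_calculus_interior_strong[where S = "{}"])
    show "(exp_smooth F has_vector_derivative F r - exp_smooth F r) (at r)" if r: "r \<in> {0<..<t} - {}" for r
    proof -
      have "isCont F r"
        using cdf_likeD(5)[OF F] r by (simp add: continuous_on_eq_continuous_at)
      then have "isCont (\<lambda>r. exp r * F r) r" by (intro continuous_intros)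
      then have "(?E has_vector_derivative exp r * F r) (at r within ({0..t} - {}))"
        using r by (intro integral_has_vector_derivative_continuous_at integral_exp_cdf_like F)
           (auto intro: continuous_at_imp_continuous_within)
      then have "(?E has_real_derivative exp r * F r) (at r within {0..t})"
        by (simp add: has_real_derivative_iff_has_vector_derivative)
      moreover have "at r within {0..t} = at r"
        using r by (intro at_within_interior) auto
      ultimately have "(?E has_real_derivative exp r * F r) (at r)" by simp
      then have "((\<lambda>r. exp (- r) * ?E r) has_real_derivative F r - exp (- r) * ?E r) (at r)"
        by (rule DERIV_cong[OF DERIV_mult, rotated]) (auto intro!: derivative_eq_intros simp: exp_minus field_simps)
      then have "(exp_smooth F has_real_derivative F r - exp (- r) * ?E r) (at r)"
        by (rule DERIV_cong_ev[THEN iffD1, rotated -1])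
           (use r eq in \<open>auto intro!: eventually_mono[OF eventually_nhds_in_open[of "{0<..<t}"]]\<close>)
      then show ?thesis
        using eq[of r] r by (simp add: has_real_derivative_iff_has_vector_derivative)
    qed
  qed (use t exp_smooth_continuous[OF F] in \<open>auto intro: continuous_on_subset\<close>)
  moreover have "((\<lambda>r. F r - exp_smooth F r) has_integral
      (integral {0..t} F - integral {0..t} (exp_smooth F))) {0..t}"
    by (intro has_integral_diff integrable_integral integrable_cdf_like F exp_smooth_cdf_like)
  ultimately have "exp_smooth F t - exp_smooth F 0 = integral {0..t} F - integral {0..t} (exp_smooth F)"
    by (rule has_integral_unique)
  then show ?thesis using exp_smooth_nonpos[OF F, of 0] by simp
next
  case False
  then show ?thesis using exp_smooth_nonpos[OF F, of t] by simp
qed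

section \<open>The truncated renewal process\<close>

text \<open>The probability that \<open>k\<close> independent exponential variables all lie in \<open>B\<close> and have sum less than \<open>t\<close>.\<close>

primrec pcdf :: "real set \<Rightarrow> nat \<Rightarrow> real \<Rightarrow> real" where
  "pcdf B 0 t = (if 0 < t then 1 else 0)"
| "pcdf B (Suc k) t = (\<integral>s. indicator B s * pcdf B k (t - s) \<partial>expX)"

lemma pcdf_basic:
  assumes [measurable]: "B \<in> sets borel"
  shows "mono (pcdf B k) \<and> (\<forall>t. 0 \<le> pcdf B k t \<and> pcdf B k t \<le> measure expX B ^ k) \<and> (\<forall>t\<le>0. pcdf B k t = 0)"
proof (induction k)
  case 0
  show ?case by (auto intro!: monoI)
next
  case (Suc k)
  let ?T = "measure expX B"
  have [measurable]: "pcdf B k \<in> borel_measurable borel" using Suc by (intro borel_measurable_mono) auto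
  have le1: "?T ^ k \<le> 1" by (auto intro: power_le_one)
  have int: "integrable expX (\<lambda>s. indicator B s * pcdf B k (t - s))" for t
    by (rule expX_integrable_bounded[where B = 1]) (use Suc le1 in \<open>auto simp: indicator_def intro: order_trans\<close>)
  have "mono (pcdf B (Suc k))"
    unfolding pcdf.simps using Suc by (intro monoI integral_mono int) (auto intro!: mult_left_mono intro: monoD)
  moreover have "0 \<le> pcdf B (Suc k) t" for t using Suc by auto
  moreover have "pcdf B (Suc k) t \<le> ?T ^ Suc k" for t
  proof -
    have "pcdf B (Suc k) t \<le> (\<integral>s. indicator B s * ?T ^ k \<partial>expX)"
      unfolding pcdf.simps
      by (rule integral_mono[OF int])
         (use Suc in \<open>auto intro!: mult_left_mono integrable_real_indicator simp: less_top[symmetric]\<close>)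
    then show ?thesis by simp
  qed
  moreover have "pcdf B (Suc k) t = 0" if "t \<le> 0" for t
    unfolding pcdf.simps
    by (rule integral_eq_zero_AE) (use AE_expX_pos in eventually_elim, use that Suc in auto)
  ultimately show ?case by blast
qed

lemma pcdf_laplace_bound:
  assumes [measurable]: "B \<in> sets borel" and th: "0 \<le> \<theta>"
    and L: "(\<integral>s. indicator B s * exp (- \<theta> * s) \<partial>expX) \<le> L"
  shows "pcdf B k t \<le> exp (\<theta> * t) * L ^ k"
proof (induction k arbitrary: t)
  case 0
  show ?case using th by (auto simp: one_le_exp_iff)
next
  case (Suc k)
  have [measurable]: "pcdf B k \<in> borel_measurable borel" 
    using pcdf_basic[of B k] by (intro borel_measurable_mono) auto
  have L0: "0 \<le> L" by (rule order_trans[OF _ L]) auto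
  have le1: "pcdf B k s \<le> 1" "0 \<le> pcdf B k s" for s
    using pcdf_basic[of B k] power_le_one[of "measure expX B" k] by (auto intro: order_trans)
  have i: "integrable expX (\<lambda>s. indicator B s * exp (- \<theta> * s))"
    using th by (intro Bochner_Integration.integrable_bound[OF expX_exp_moment(1)[of "- \<theta>"]]) (auto simp: indicator_def)
  have "pcdf B (Suc k) t \<le> (\<integral>s. (exp (\<theta> * t) * L ^ k) * (indicator B s * exp (- \<theta> * s)) \<partial>expX)"
    unfolding pcdf.simps
  proof (rule integral_mono)
    show "integrable expX (\<lambda>s. indicator B s * pcdf B k (t - s))"
      by (rule expX_integrable_bounded[where B = 1]) (use le1 in \<open>auto simp: indicator_def\<close>)
    show "indicator B s * pcdf B k (t - s) \<le> (exp (\<theta> * t) * L ^ k) * (indicator B s * exp (- \<theta> * s))" for s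
      using Suc[of "t - s"] by (auto simp: indicator_def algebra_simps exp_diff exp_minus field_simps)
  qed (use i in auto)
  also have "\<dots> = (exp (\<theta> * t) * L ^ k) * (\<integral>s. indicator B s * exp (- \<theta> * s) \<partial>expX)"
    by simp
  also have "\<dots> \<le> (exp (\<theta> * t) * L ^ k) * L"
    using L L0 by (intro mult_left_mono) auto
  finally show ?case by (simp add: mult_ac)
qed

text \<open>With \<theta> = e / 2, and 1 / (1 + \<theta>) the Laplace transform of the exponential
  law, the bound ln (1 + \<theta>) \<ge> \<theta> - \<theta>^2 leaves the exponent n (\<theta>^2 - e
  \<theta>), which this \<theta> minimises.\<close>

lemma chernoff_exponent:
  fixes e Q :: real and n :: nat
  assumes e: "0 \<le> e" "e \<le> 1" and Q: "Q \<le> (1 - e) * real n"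
  shows "exp (e / 2 * Q) * (1 / (1 + e / 2)) ^ n \<le> exp (- real n * e\<^sup>2 / 4)"
proof -
  have "exp (real n * ln (1 + e / 2)) = (1 + e / 2) ^ n"
    using e by (simp add: exp_of_nat_mult)
  then have "exp (e / 2 * Q) * (1 / (1 + e / 2)) ^ n = exp (e / 2 * Q - n * ln (1 + e / 2))"
    unfolding exp_diff power_one_over by simp
  also have "\<dots> \<le> exp (- real n * e\<^sup>2 / 4)"
  proof -
    have "e / 2 - (e / 2)\<^sup>2 \<le> ln (1 + e / 2)"
      using e by (intro ln_one_plus_pos_lower_bound) auto
    then have "n * (e / 2 - (e / 2)\<^sup>2) \<le> n * ln (1 + e / 2)" by (intro mult_left_mono) auto
    moreover have "e / 2 * Q \<le> e / 2 * ((1 - e) * n)" using e Q by (intro mult_left_mono) auto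
    ultimately show ?thesis by (simp add: power2_eq_square field_simps)
  qed
  finally show ?thesis .
qed

section \<open>A delay equation and its renewal process\<close>

lemma integral_shift_real:
  fixes f :: "real \<Rightarrow> real"
  assumes "f integrable_on {a - y..b - y}"
  shows "((\<lambda>r. f (r - y)) has_integral integral {a - y..b - y} f) {a..b}"
proof (cases "a \<le> b")
  case True
  have "(\<lambda>x. x + y) ` {a - y..b - y} = {a..b}" by (simp add: True)
  then show ?thesis
    using has_integral_affinity[of f "integral {a - y..b - y} f" "a - y" "b - y" 1 "- y"]
      integrable_integral[OF assms] by simp
qed auto

text \<open>Each delay that fits below \<open>t\<close> gains a factor \<open>c * y\<close>: the
  bound for \<open>j\<close> holds on the window of length \<open>y\<close> before \<open>t\<close>
  and is integrated over it. The inhomogeneity accumulates to at most \<open>2 * \<eta>\<close>, a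
  value that \<open>c * y \<le> 1 / 2\<close> reproduces:
  \<open>c * y * (2 * \<eta>) + \<eta> \<le> 2 * \<eta>\<close>.\<close>

lemma delay_contraction:
  fixes D :: "real \<Rightarrow> real"
  assumes y: "0 < y" and c: "0 \<le> c" "c * y \<le> 1 / 2" and \<eta>: "0 \<le> \<eta>"
    and int: "\<And>a b. D integrable_on {a..b}"
    and step: "\<And>t. y < t \<Longrightarrow> t \<le> Q \<Longrightarrow> \<bar>D t\<bar> \<le> c * \<bar>integral {t - y..t} D\<bar> + \<eta>"
    and bd: "\<And>t. 0 < t \<Longrightarrow> t \<le> Q \<Longrightarrow> \<bar>D t\<bar> \<le> B" and B: "0 \<le> B"
    and t: "real j * y < t" "t \<le> Q"
  shows "\<bar>D t\<bar> \<le> (c * y) ^ j * B + 2 * \<eta>"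
  using t
proof (induction j arbitrary: t)
  case 0
  then show ?case using bd[of t] \<eta> by auto
next
  case (Suc j)
  let ?C = "(c * y) ^ j * B + 2 * \<eta>"
  have jy: "real j * y < t - y" using Suc.prems by (simp add: algebra_simps)
  have "0 \<le> real j * y" using y by auto
  have C: "0 \<le> ?C" using c y B \<eta> by auto
  have "norm (integral {t - y..t} D) \<le> ?C * measure lborel {t - y..t}"
    using Suc.IH jy Suc.prems by (intro has_integral_bound_real[OF C finite.emptyI integrable_integral[OF int]]) auto
  then have "\<bar>integral {t - y..t} D\<bar> \<le> ?C * y" using y by simp
  then have "c * \<bar>integral {t - y..t} D\<bar> \<le> c * (?C * y)" using c by (intro mult_left_mono)
  moreover have "c * (?C * y) = (c * y) ^ Suc j * B + (c * y) * (2 * \<eta>)" by (simp add: algebra_simps)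
  moreover have "(c * y) * (2 * \<eta>) \<le> 1 / 2 * (2 * \<eta>)" using c \<eta> by (intro mult_right_mono) auto
  moreover have "\<bar>D t\<bar> \<le> c * \<bar>integral {t - y..t} D\<bar> + \<eta>" using step jy \<open>0 \<le> real j * y\<close> Suc.prems by auto
  ultimately show ?case by linarith
qed

text \<open>One setting for both extreme agents: \<open>split\<close> says that the exponential law
  restricted to \<open>B\<close> is \<alpha> times the full law plus \<beta> times its shift by
  \<open>y\<close>. The weight \<beta> may be negative, as it is for \<open>{..y}\<close>.\<close>

locale renewal =
  fixes B :: "real set" and y \<alpha> \<beta> :: real
  assumes y: "0 < y" and B [measurable]: "B \<in> sets borel"
    and T_pos: "0 < \<alpha> + \<beta>" and T_eq: "measure expX B = \<alpha> + \<beta>"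
    and split: "\<And>F t. cdf_like F \<Longrightarrow>
      (\<integral>s. indicator B s * F (t - s) \<partial>expX) = \<alpha> * exp_smooth F t + \<beta> * exp_smooth F (t - y)"
begin

text \<open>\<open>T\<close> is P(B). Dividing by \<open>T ^ k\<close> makes \<open>G k\<close> the
  distribution function of k steps conditioned on \<open>B\<close>, and \<open>mass\<close> solves w
  = y + d y w, the equation for a constant window count.\<close>

definition T :: real where "T = \<alpha> + \<beta>"
definition d :: real where "d = - \<beta> / T"
definition G :: "nat \<Rightarrow> real \<Rightarrow> real" where "G k t = pcdf B k t / T ^ k"
definition mass :: real where "mass = y / (1 - d * y)"

lemma T: "0 < T" and T_le1: "T \<le> 1"
  using T_pos T_eq expX.prob_le_1[of B] by (auto simp: T_def)

text \<open>Continuity is the only new point; after the first step it follows from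
  \<open>split\<close>, because smoothing also removes the jump at 0.\<close>

lemma cdf_like_pcdf: "cdf_like (pcdf B k)"
proof (induction k)
  case 0
  have "continuous_on {0<..} (\<lambda>t::real. 1::real)" by simp
  then have "continuous_on {0<..} (pcdf B 0)" by (rule continuous_on_eq) auto
  then show ?case unfolding cdf_like_def by (auto intro!: monoI)
next
  case (Suc k)
  have "pcdf B (Suc k) = (\<lambda>t. \<alpha> * exp_smooth (pcdf B k) t + \<beta> * exp_smooth (pcdf B k) (t - y))"
    using split[OF Suc] by (auto simp: fun_eq_iff)
  moreover have "continuous_on UNIV (\<lambda>t. \<alpha> * exp_smooth (pcdf B k) t + \<beta> * exp_smooth (pcdf B k) (t - y))"
    by (intro continuous_intros exp_smooth_continuous[OF Suc]
       continuous_on_compose2[OF exp_smooth_continuous[OF Suc]]) auto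
  ultimately have "continuous_on {0<..} (pcdf B (Suc k))"
    by (metis continuous_on_subset subset_UNIV)
  moreover have "measure expX B ^ Suc k \<le> 1" by (rule power_le_one) auto
  ultimately show ?case unfolding cdf_like_def using pcdf_basic[OF B, of "Suc k"] by (auto intro: order_trans)
qed

lemma cdf_like_G: "cdf_like (G k)"
proof -
  have "pcdf B k t \<le> T ^ k" for t using pcdf_basic[OF B, of k] by (auto simp: T_eq T_def)
  then show ?thesis
    using cdf_likeD[OF cdf_like_pcdf[of k]] T
    unfolding cdf_like_def G_def by (auto intro!: monoI divide_right_mono continuous_intros dest: monoD)
qed

lemma G_Suc: "G (Suc k) t = (1 + d) * exp_smooth (G k) t - d * exp_smooth (G k) (t - y)"
proof -
  have "exp_smooth (G k) r = exp_smooth (pcdf B k) r / T ^ k" for r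
    by (simp add: exp_smooth_def G_def)
  moreover have "1 + d = \<alpha> / T" using T by (auto simp: d_def T_def field_simps)
  ultimately show ?thesis
    using split[OF cdf_like_pcdf, of k t] T by (simp add: G_def d_def add_divide_distrib)
qed

text \<open>\<open>exp_smooth_primitive\<close> at \<open>t\<close> and at \<open>t - y\<close>,
  combined with the weights of \<open>G_Suc\<close>. This is the integrated equation for the step
  density, convolved with \<open>G k\<close>.\<close>

lemma G_Suc_primitive:
  "G (Suc k) t + integral {0..t} (G (Suc k))
     = (1 + d) * integral {0..t} (G k) - d * integral {0..t - y} (G k)"
proof -
  let ?S = "exp_smooth (G k)"
  note S = exp_smooth_cdf_like[OF cdf_like_G[of k]]
  have "((\<lambda>r. ?S (r - y)) has_integral integral {0 - y..t - y} ?S) {0..t}"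
    by (rule integral_shift_real integrable_cdf_like S)+
  moreover have "integral {0 - y..t - y} ?S = integral {0..t - y} ?S"
    by (intro integral_spike_set; rule negligible_subset[OF negligible_empty])
       (use cdf_likeD(4)[OF S] y in force)+
  ultimately have *: "((\<lambda>r. ?S (r - y)) has_integral integral {0..t - y} ?S) {0..t}" by simp
  have "((\<lambda>r. (1 + d) * ?S r - d * ?S (r - y)) has_integral
      (1 + d) * integral {0..t} ?S - d * integral {0..t - y} ?S) {0..t}"
    by (intro has_integral_diff has_integral_mult_right * integrable_integral integrable_cdf_like S)
  then have "integral {0..t} (G (Suc k)) = (1 + d) * integral {0..t} ?S - d * integral {0..t - y} ?S"
    by (simp add: G_Suc[abs_def] integral_unique)
  then show ?thesis
    unfolding G_Suc[of k t] exp_smooth_primitive[OF cdf_like_G[of k], symmetric]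
    by (simp add: algebra_simps)
qed

context
  fixes n :: nat
begin

text \<open>\<open>U\<close> is the renewal function of the first \<open>n\<close> partial sums, the
  empty sum included; \<open>err\<close> is the boundary term that remains because the sum stops at
  \<open>n\<close>.\<close>

definition U :: "real \<Rightarrow> real" where "U t = (\<Sum>k<n. G k t)"
definition W :: "real \<Rightarrow> real" where "W t = U t - U (t - y)"
definition err :: "real \<Rightarrow> real" where "err t = G n t + integral {0..t} (G n)"

lemma U_integrable: "U integrable_on {a..b}"
  unfolding U_def[abs_def] by (intro integrable_sum integrable_cdf_like cdf_like_G) auto

text \<open>Summing \<open>G_Suc_primitive\<close> over k < n telescopes. The end at k = 0
  contributes \<open>1 + t\<close>, the height of \<open>G 0\<close> plus its integral, and the end
  at \<open>n\<close> contributes \<open>err\<close>.\<close>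

lemma U_equation:
  assumes "0 < t"
  shows "U t = 1 + t - err t + d * (integral {0..t} U - integral {0..t - y} U)"
proof -
  have I: "integral {0..r} U = (\<Sum>k<n. integral {0..r} (G k))" for r
    unfolding U_def[abs_def] by (intro integral_sum integrable_cdf_like cdf_like_G) auto
  have "(\<Sum>k<n. (G (Suc k) t + integral {0..t} (G (Suc k))) - (G k t + integral {0..t} (G k)))
      = err t - (G 0 t + integral {0..t} (G 0))"
    by (subst sum_lessThan_telescope) (simp add: err_def)
  also have "(\<Sum>k<n. (G (Suc k) t + integral {0..t} (G (Suc k))) - (G k t + integral {0..t} (G k)))
     = (1 + d) * integral {0..t} U - d * integral {0..t - y} U - (U t + integral {0..t} U)"
    unfolding G_Suc_primitive by (simp add: I U_def sum_subtractf sum.distrib sum_distrib_left)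
  finally have "U t = (G 0 t + integral {0..t} (G 0)) - err t + d * (integral {0..t} U - integral {0..t - y} U)"
    by (simp add: algebra_simps)
  moreover have "((\<lambda>_. 1) has_integral t) {0..t}"
    using has_integral_const_real[of "1::real" 0 t] assms by simp
  then have "(G 0 has_integral t) {0..t}"
    by (rule has_integral_spike_finite[of "{0}", rotated -1]) (auto simp: G_def)
  then have "G 0 t + integral {0..t} (G 0) = 1 + t"
    using assms by (simp add: integral_unique G_def)
  ultimately show ?thesis by simp
qed

text \<open>The difference of \<open>U_equation\<close> at \<open>t\<close> and at
  \<open>t - y\<close>: the linear term leaves \<open>y\<close>, and the integrals of
  \<open>U\<close> over two adjacent windows form one integral of \<open>W\<close>. The assumption
  keeps both arguments positive.\<close>

lemma W_equation:
  assumes "y < t"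
  shows "W t = y - (err t - err (t - y)) + d * integral {t - y..t} W"
proof -
  have c: "integral {0..s} U - integral {0..s - y} U = integral {s - y..s} U" if "0 \<le> s" for s
  proof (cases "y \<le> s")
    case True
    then show ?thesis
      using Henstock_Kurzweil_Integration.integral_combine[of 0 "s - y" s U] U_integrable y by auto
  next
    case False
    \<comment> \<open>\<open>U\<close> vanishes on the nonpositive axis, so the part of the window
      left of 0 adds nothing.\<close>
    have "integral {s - y..0} U = 0"
      using Henstock_Kurzweil_Integration.integral_cong[of "{s - y..0}" U "\<lambda>_. 0"] cdf_likeD(4)[OF cdf_like_G]
      by (simp add: U_def)
    then show ?thesis
      using Henstock_Kurzweil_Integration.integral_combine[of "s - y" 0 s U] U_integrable False that by auto
  qed
  have "((\<lambda>r. U (r - y)) has_integral integral {t - y - y..t - y} U) {t - y..t}"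
    by (rule integral_shift_real U_integrable)+
  then have "(W has_integral integral {t - y..t} U - integral {t - y - y..t - y} U) {t - y..t}"
    unfolding W_def[abs_def] by (intro has_integral_diff integrable_integral U_integrable)
  then have "integral {t - y..t} W = integral {t - y..t} U - integral {t - y - y..t - y} U"
    by (rule integral_unique)
  then have "d * integral {t - y..t} W = d * integral {t - y..t} U - d * integral {t - y - y..t - y} U"
    by (simp add: right_diff_distrib)
  then show ?thesis
    using U_equation[of t] U_equation[of "t - y"] c[of t] c[of "t - y"] assms y
    by (simp add: W_def)
qed

lemma W_integrable: "W integrable_on {a..b}"
proof -
  have "(\<lambda>r. U (r - y)) integrable_on {a..b}"
    using integral_shift_real[OF U_integrable, of y a b] by blast
  then show ?thesis unfolding W_def[abs_def] by (intro integrable_diff U_integrable)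
qed

lemma W_bounds: "0 \<le> W t" "W t \<le> n"
proof -
  have "0 \<le> G k t - G k (t - y)" "G k t - G k (t - y) \<le> 1" for k
    using cdf_likeD[OF cdf_like_G[of k]] y monoD[OF cdf_likeD(1)[OF cdf_like_G[of k]], of "t - y" t]
    by (auto simp: add_increasing2 diff_le_eq)
  then have "0 \<le> (\<Sum>k<n. G k t - G k (t - y))" "(\<Sum>k<n. G k t - G k (t - y)) \<le> (\<Sum>k<n. 1)"
    by (intro sum_nonneg sum_mono; simp)+
  then show "0 \<le> W t" "W t \<le> n" by (auto simp: W_def U_def sum_subtractf)
qed

text \<open>Both parts of \<open>err\<close> are controlled at the single time \<open>Q\<close>,
  because \<open>G n\<close> is monotone; the Chernoff bound is therefore needed only there.\<close>

lemma err_bounds: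
  assumes "0 \<le> t" "t \<le> Q"
  shows "0 \<le> err t" "err t \<le> (1 + Q) * G n Q"
proof -
  note G = cdf_likeD[OF cdf_like_G[of n]]
  have "0 \<le> integral {0..t} (G n)" by (intro integral_nonneg integrable_cdf_like cdf_like_G) (use G in auto)
  then show "0 \<le> err t" using G by (simp add: err_def)
  have "norm (integral {0..t} (G n)) \<le> G n Q * measure lborel {0..t}"
    using G assms
    by (intro has_integral_bound_real[OF _ finite.emptyI integrable_integral[OF integrable_cdf_like[OF cdf_like_G]]])
       (auto intro!: monoD[OF G(1)])
  also have "\<dots> \<le> G n Q * Q" using assms G by (auto intro!: mult_left_mono)
  finally show "err t \<le> (1 + Q) * G n Q"
    using monoD[OF G(1) assms(2)] by (simp add: err_def algebra_simps)
qed

text \<open>\<open>W - mass\<close> satisfies a homogeneous delay equation up to \<open>err\<close>.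
  The hypothesis \<open>half\<close> keeps the accumulated truncation error bounded, while
  \<open>ex\<close> converts the number of delays, about Q / y, into the exponent (y - Q) /
  2.\<close>

lemma renewal_error:
  assumes Q: "0 < Q" and half: "\<bar>d\<bar> * y \<le> 1 / 2" and ex: "\<bar>d\<bar> * y \<le> exp (- y / 2)"
  shows "\<bar>W Q - mass\<bar> \<le> (n + 2 * y) * exp ((y - Q) / 2) + 2 * ((1 + Q) * G n Q)"
proof -
  define D where "D = (\<lambda>t. W t - mass)"
  let ?\<eta> = "(1 + Q) * G n Q" and ?B = "n + 2 * y"
  have dy: "d * y \<le> 1 / 2"
    using half mult_right_mono[OF abs_ge_self, of y d] y by linarith
  have "mass * (1 - d * y) = y" using dy by (simp add: mass_def)
  then have fixpoint: "mass = y + d * (y * mass)" by (simp add: algebra_simps)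
  have "y / (1 - d * y) \<le> y / (1 / 2)" using dy y by (intro divide_left_mono) auto
  then have mass: "0 \<le> mass" "mass \<le> 2 * y" using dy y by (auto simp: mass_def)
  have step: "\<bar>D t\<bar> \<le> \<bar>d\<bar> * \<bar>integral {t - y..t} D\<bar> + ?\<eta>" if t: "y < t" "t \<le> Q" for t
  proof -
    have "(D has_integral integral {t - y..t} W - mass * y) {t - y..t}"
      unfolding D_def using has_integral_const_real[of mass "t - y" t] y
      by (intro has_integral_diff integrable_integral W_integrable) (auto simp: mult.commute)
    then have "integral {t - y..t} D = integral {t - y..t} W - mass * y" by (rule integral_unique)
    then have "D t = d * integral {t - y..t} D - (err t - err (t - y))"
      using W_equation[OF t(1)] fixpoint unfolding D_def
      by (simp only: right_diff_distrib mult.commute[of mass])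
    moreover have "\<bar>err t - err (t - y)\<bar> \<le> ?\<eta>"
      using err_bounds[of t Q] err_bounds[of "t - y" Q] t y by auto
    ultimately show ?thesis
      using abs_mult[of d "integral {t - y..t} D"] by linarith
  qed
  have bd: "\<bar>D t\<bar> \<le> ?B" for t using W_bounds[of t] mass y by (auto simp: D_def)
  \<comment> \<open>The largest \<open>j\<close> with \<open>j * y < Q\<close>: ceiling minus one
    keeps the inequality strict, and at most one delay is lost.\<close>
  define j where "j = nat (\<lceil>Q / y\<rceil> - 1)"
  have "0 < Q / y" using Q y by simp
  then have j: "real j = real_of_int \<lceil>Q / y\<rceil> - 1" unfolding j_def by linarith
  have "real j < Q / y" "Q / y - 1 \<le> real j" unfolding j by linarith+
  then have jy: "real j * y < Q" "Q - y \<le> real j * y" using y by (auto simp: field_simps)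
  have "\<bar>D Q\<bar> \<le> (\<bar>d\<bar> * y) ^ j * ?B + 2 * ?\<eta>"
  proof (rule delay_contraction[OF y _ half _ _ step bd _ jy(1)])
    show "0 \<le> ?\<eta>" using cdf_likeD(2)[OF cdf_like_G] Q by simp
    show "D integrable_on {a..b}" for a b unfolding D_def by (intro integrable_diff W_integrable integrable_const[of _ a b, simplified])
  qed (use y in auto)
  also have "(\<bar>d\<bar> * y) ^ j * ?B \<le> exp ((y - Q) / 2) * ?B"
  proof (rule mult_right_mono)
    have "(\<bar>d\<bar> * y) ^ j \<le> exp (- y / 2) ^ j" by (rule power_mono) (use ex y in auto)
    also have "\<dots> = exp (- (real j * y) / 2)" by (simp flip: exp_of_nat_mult)
    also have "\<dots> \<le> exp ((y - Q) / 2)" using jy by simp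
    finally show "(\<bar>d\<bar> * y) ^ j \<le> exp ((y - Q) / 2)" .
  qed (use y in auto)
  finally show ?thesis by (simp add: D_def mult.commute)
qed

end

end

section \<open>Expected Shapley values as renewal probabilities\<close>

text \<open>The law up to \<open>y\<close> is the full law minus the law above \<open>y\<close>, and
  the latter is a shifted copy by memorylessness; hence the negative weight.\<close>

lemma renewal_atMost:
  assumes y: "0 < y"
  shows "renewal {..y} y 1 (- exp (- y))"
proof
  show "(\<integral>s. indicator {..y} s * F (t - s) \<partial>expX) = 1 * exp_smooth F t + - exp (- y) * exp_smooth F (t - y)"
    if F: "cdf_like F" for F t
  proof -
    note [measurable] = cdf_likeD(6)[OF F]
    have i: "integrable expX (\<lambda>s. F (t - s))" "integrable expX (\<lambda>s. indicator {y<..} s * F (t - s))"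
      by (rule expX_integrable_bounded[where B = 1]; use cdf_likeD(2,3)[OF F] in \<open>simp add: indicator_def\<close>)+
    have "(\<integral>s. indicator {..y} s * F (t - s) \<partial>expX)
        = (\<integral>s. F (t - s) - indicator {y<..} s * F (t - s) \<partial>expX)"
      by (rule Bochner_Integration.integral_cong) (auto simp: indicator_def)
    also have "\<dots> = exp_smooth F t - exp (- y) * exp_smooth F (t - y)"
      using y expX_shift[of "\<lambda>s. F (t - s)" y] by (simp add: i exp_smooth_def diff_diff_eq)
    finally show ?thesis by simp
  qed
qed (use y in \<open>auto simp: measure_expX_atMost\<close>)

lemma renewal_greaterThan:
  assumes y: "0 < y"
  shows "renewal {y<..} y 0 (exp (- y))"
proof
  show "(\<integral>s. indicator {y<..} s * F (t - s) \<partial>expX) = 0 * exp_smooth F t + exp (- y) * exp_smooth F (t - y)"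
    if F: "cdf_like F" for F t
  proof -
    note [measurable] = cdf_likeD(6)[OF F]
    show ?thesis
      using y expX_shift[of "\<lambda>s. F (t - s)" y] by (simp add: exp_smooth_def diff_diff_eq)
  qed
qed (use y in \<open>auto simp: measure_expX_greaterThan\<close>)

text \<open>Coordinates are integrated out one at a time. One in \<open>A\<close> lowers the
  threshold \<open>t\<close> by its value and performs a step of the recursion for
  \<open>pcdf\<close>; one outside \<open>A\<close> contributes a factor
  \<open>measure expX B\<close>. The predicate may depend on \<open>j\<close>, because only its
  almost sure agreement with \<open>B\<close> matters; this is where tie-breaking
  disappears.\<close>

lemma nn_integral_PiM_pcdf:
  fixes P :: "nat \<Rightarrow> real \<Rightarrow> bool"
  assumes [measurable]: "\<And>j. Measurable.pred borel (P j)" "B \<in> sets borel"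
    and P: "\<And>j. AE s in expX. P j s \<longleftrightarrow> s \<in> B"
    and J: "finite J" "A \<subseteq> J"
  shows "(\<integral>\<^sup>+x. (if (\<forall>j\<in>J. P j (x j)) \<and> (\<Sum>j\<in>A. x j) < t then 1 else 0) \<partial>PiM J (\<lambda>_. expX))
      = ennreal (measure expX B ^ card (J - A) * pcdf B (card A) t)"
  using J
proof (induction J arbitrary: A t rule: finite_induct)
  case empty
  then show ?case by (simp add: nn_integral_empty PiM_empty nn_integral_count_space_finite)
next
  case (insert i J)
  interpret PF: product_sigma_finite "\<lambda>_::nat. expX" by unfold_locales
  let ?T = "measure expX B"
  have [measurable]: "pcdf B k \<in> borel_measurable borel" for k
    using pcdf_basic[of B k] by (intro borel_measurable_mono) auto
  have finA: "finite A" using insert finite_subset by blast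
  define A' where "A' = A - {i}"
  have A': "A' \<subseteq> J" "finite A'" using insert.prems finA by (auto simp: A'_def)
  define u where "u y = (if i \<in> A then t - y else t)" for y :: real
  have sum_upd: "(\<Sum>j\<in>A. (x(i := y)) j) < t \<longleftrightarrow> (\<Sum>j\<in>A'. x j) < u y" for x :: "nat \<Rightarrow> real" and y
  proof (cases "i \<in> A")
    case True
    have "(\<Sum>j\<in>A. (x(i := y)) j) = y + (\<Sum>j\<in>A'. (x(i := y)) j)"
      using True finA by (simp add: A'_def sum.remove)
    also have "(\<Sum>j\<in>A'. (x(i := y)) j) = (\<Sum>j\<in>A'. x j)" by (rule sum.cong) (auto simp: A'_def)
    finally show ?thesis using True by (auto simp: u_def)
  next
    case False
    then have "(\<Sum>j\<in>A. (x(i := y)) j) = (\<Sum>j\<in>A'. x j)" by (intro sum.cong) (auto simp: A'_def)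
    then show ?thesis using False by (auto simp: u_def)
  qed
  have all_upd: "(\<forall>j\<in>insert i J. P j ((x(i := y)) j)) \<longleftrightarrow> P i y \<and> (\<forall>j\<in>J. P j (x j))"
    for x :: "nat \<Rightarrow> real" and y using insert.hyps by auto
  have meas: "(\<lambda>x. if (\<forall>j\<in>insert i J. P j (x j)) \<and> (\<Sum>j\<in>A. x j) < t then 1 else 0 :: ennreal)
      \<in> borel_measurable (PiM (insert i J) (\<lambda>_. expX))"
    using insert.hyps subsetD[OF insert.prems] by measurable
  have "(\<integral>\<^sup>+x. (if (\<forall>j\<in>insert i J. P j (x j)) \<and> (\<Sum>j\<in>A. x j) < t then 1 else 0) \<partial>PiM (insert i J) (\<lambda>_. expX))
     = (\<integral>\<^sup>+y. (\<integral>\<^sup>+x. (if P i y then 1 else 0) * (if (\<forall>j\<in>J. P j (x j)) \<and> (\<Sum>j\<in>A'. x j) < u y then 1 else 0) \<partial>PiM J (\<lambda>_. expX)) \<partial>expX)"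
    unfolding PF.product_nn_integral_insert_rev[OF insert.hyps meas] all_upd sum_upd
    by (intro nn_integral_cong) auto
  also have "\<dots> = (\<integral>\<^sup>+y. (if P i y then ennreal (?T ^ card (J - A') * pcdf B (card A') (u y)) else 0) \<partial>expX)"
    by (intro nn_integral_cong) (simp add: insert.IH[OF A'(1)])
  also have "\<dots> = (\<integral>\<^sup>+y. ennreal (?T ^ card (J - A') * (indicator B y * pcdf B (card A') (u y))) \<partial>expX)"
    by (rule nn_integral_cong_AE) (use P[of i] in eventually_elim, auto simp: indicator_def)
  also have "\<dots> = ennreal (\<integral>y. ?T ^ card (J - A') * (indicator B y * pcdf B (card A') (u y)) \<partial>expX)"
  proof (rule nn_integral_eq_integral)
    have b: "0 \<le> pcdf B k s" "pcdf B k s \<le> 1" for k s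
      using pcdf_basic[of B k] power_le_one[of "measure expX B" k] by (auto intro: order_trans)
    have [measurable]: "u \<in> borel_measurable borel" unfolding u_def by measurable
    have "integrable expX (\<lambda>y. indicator B y * pcdf B (card A') (u y))"
      by (rule expX_integrable_bounded[where B = 1]) (use b in \<open>auto simp: indicator_def\<close>)
    then show "integrable expX (\<lambda>y. ?T ^ card (J - A') * (indicator B y * pcdf B (card A') (u y)))"
      by (rule integrable_mult_right)
    show "AE y in expX. 0 \<le> ?T ^ card (J - A') * (indicator B y * pcdf B (card A') (u y))"
      using b by auto
  qed
  also have "(\<integral>y. ?T ^ card (J - A') * (indicator B y * pcdf B (card A') (u y)) \<partial>expX)
     = ?T ^ card (insert i J - A) * pcdf B (card A) t"
  proof (cases "i \<in> A")
    case True
    then have "insert i J - A = J - A'" "card A = Suc (card A')"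
      using insert.hyps finA card_Suc_Diff1[OF finA True] by (auto simp: A'_def)
    then show ?thesis using True by (simp add: u_def)
  next
    case False
    then have "insert i J - A = insert i (J - A')" "A = A'" by (auto simp: A'_def)
    then show ?thesis using False insert.hyps by (simp add: u_def)
  qed
  finally show ?case .
qed

section \<open>Shapley values under relabelling and sorting\<close>

definition pivotal :: "nat \<Rightarrow> real \<Rightarrow> (nat \<Rightarrow> nat) \<Rightarrow> nat \<Rightarrow> (nat \<Rightarrow> real) \<Rightarrow> bool" where
  "pivotal n Q p i w \<longleftrightarrow> Q - w i \<le> (\<Sum>j\<in>{j. j < n \<and> p j < p i}. w j)
     \<and> (\<Sum>j\<in>{j. j < n \<and> p j < p i}. w j) < Q"

lemma shapley_eq_card: "shapley n w i Q = card {p. p permutes {..<n} \<and> pivotal n Q p i w} / fact n"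
  by (simp add: shapley_def pivotal_def)

lemma shapley_eq_sum:
  "shapley n w i Q = (\<Sum>p | p permutes {..<n}. of_bool (pivotal n Q p i w)) / fact n"
proof -
  have "finite {p. p permutes {..<n}}" by (rule finite_permutations) simp
  then have "(\<Sum>p | p permutes {..<n}. of_bool (pivotal n Q p i w) :: real)
     = card ({p. p permutes {..<n}} \<inter> {p. pivotal n Q p i w})"
    by (simp add: sum_of_bool_eq)
  also have "{p. p permutes {..<n}} \<inter> {p. pivotal n Q p i w} = {p. p permutes {..<n} \<and> pivotal n Q p i w}"
    by auto
  finally show ?thesis by (simp add: shapley_eq_card)
qed

lemma shapley_cong:
  assumes "i < n" "\<And>j. j < n \<Longrightarrow> w j = w' j"
  shows "shapley n w i Q = shapley n w' i Q"
proof -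
  have "pivotal n Q p i w = pivotal n Q p i w'" for p
  proof -
    have "(\<Sum>j\<in>{j. j < n \<and> p j < p i}. w j) = (\<Sum>j\<in>{j. j < n \<and> p j < p i}. w' j)"
      by (rule sum.cong) (auto simp: assms)
    then show ?thesis using assms by (simp add: pivotal_def)
  qed
  then show ?thesis by (simp add: shapley_eq_card)
qed

text \<open>Relabelling the agents by \<sigma> amounts to reading each ordering through
  \<open>inv \<sigma>\<close>, a bijection on orderings that preserves being pivotal.\<close>

lemma shapley_permute:
  assumes \<sigma>: "\<sigma> permutes {..<n}"
  shows "shapley n (w \<circ> \<sigma>) k Q = shapley n w (\<sigma> k) Q"
proof -
  have piv: "pivotal n Q p k (w \<circ> \<sigma>) = pivotal n Q (p \<circ> inv \<sigma>) (\<sigma> k) w" for p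
  proof -
    have "(\<Sum>j\<in>{j. j < n \<and> p j < p k}. w (\<sigma> j))
        = (\<Sum>j\<in>{j. j < n \<and> (p \<circ> inv \<sigma>) j < (p \<circ> inv \<sigma>) (\<sigma> k)}. w j)"
    proof (rule sum.reindex_bij_witness[where i = "inv \<sigma>" and j = \<sigma>])
    qed (use permutes_in_image[OF \<sigma>] permutes_in_image[OF permutes_inv[OF \<sigma>]] in
        \<open>auto simp: permutes_inverses[OF \<sigma>]\<close>)
    then show ?thesis by (simp add: pivotal_def)
  qed
  have "bij_betw (\<lambda>p. p \<circ> inv \<sigma>) {p. p permutes {..<n} \<and> pivotal n Q p k (w \<circ> \<sigma>)}
      {p. p permutes {..<n} \<and> pivotal n Q p (\<sigma> k) w}"
  proof (rule bij_betw_byWitness[where f' = "\<lambda>p. p \<circ> \<sigma>"])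
    have "p \<circ> \<sigma> \<circ> inv \<sigma> = p" "p \<circ> inv \<sigma> \<circ> \<sigma> = p" for p :: "nat \<Rightarrow> nat"
      by (simp_all add: o_assoc[symmetric] permutes_inv_o[OF \<sigma>])
    then show "\<forall>p\<in>{p. p permutes {..<n} \<and> pivotal n Q p k (w \<circ> \<sigma>)}. p \<circ> inv \<sigma> \<circ> \<sigma> = p"
      "\<forall>p\<in>{p. p permutes {..<n} \<and> pivotal n Q p (\<sigma> k) w}. p \<circ> \<sigma> \<circ> inv \<sigma> = p"
      "(\<lambda>p. p \<circ> inv \<sigma>) ` {p. p permutes {..<n} \<and> pivotal n Q p k (w \<circ> \<sigma>)}
         \<subseteq> {p. p permutes {..<n} \<and> pivotal n Q p (\<sigma> k) w}"
      "(\<lambda>p. p \<circ> \<sigma>) ` {p. p permutes {..<n} \<and> pivotal n Q p (\<sigma> k) w}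
         \<subseteq> {p. p permutes {..<n} \<and> pivotal n Q p k (w \<circ> \<sigma>)}"
      using \<sigma> by (auto simp: piv intro: permutes_compose permutes_inv)
  qed
  then show ?thesis by (simp add: shapley_eq_card bij_betw_same_card)
qed

lemma sorted_weights_permutation:
  obtains \<sigma> where "\<sigma> permutes {..<n}" "\<And>j. j < n \<Longrightarrow> sorted_weights n x j = x (\<sigma> j)"
proof -
  have "mset (sort (map x [0..<n])) = mset (map x [0..<n])" by simp
  then obtain \<sigma> where \<sigma>: "\<sigma> permutes {..<length (map x [0..<n])}"
    "permute_list \<sigma> (map x [0..<n]) = sort (map x [0..<n])"
    by (rule mset_eq_permutation)
  have "sorted_weights n x j = x (\<sigma> j)" if "j < n" for j
    using that \<sigma> permutes_in_image[OF \<sigma>(1), of j]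
    unfolding sorted_weights_def \<sigma>(2)[symmetric] by (simp add: permute_list_nth)
  then show thesis using \<sigma>(1) that by simp
qed

text \<open>The Shapley value sees only the weight, not the index, so any agent carrying the weight
  of rank \<open>k\<close> may stand for the sorted agent. The selected agent may thus differ from
  the one that sorting chooses among equal weights.\<close>

lemma shapley_sorted_weights:
  assumes "k < n" "i < n" "sorted_weights n x k = x i"
  shows "shapley n (sorted_weights n x) k Q = shapley n x i Q"
proof -
  obtain \<sigma> where \<sigma>: "\<sigma> permutes {..<n}" "\<And>j. j < n \<Longrightarrow> sorted_weights n x j = x (\<sigma> j)"
    by (rule sorted_weights_permutation[of n x]) blast
  have k: "\<sigma> k < n" using permutes_in_image[OF \<sigma>(1)] assms by auto
  have eq: "x (\<sigma> k) = x i" using \<sigma>(2)[of k] assms by simp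
  \<comment> \<open>Swapping two agents of equal weight leaves \<open>x\<close> unchanged.\<close>
  define \<tau> where "\<tau> = Transposition.transpose (\<sigma> k) i"
  have \<tau>: "\<tau> permutes {..<n}" unfolding \<tau>_def by (rule permutes_swap_id) (use k assms in auto)
  have x\<tau>: "x \<circ> \<tau> = x" using eq by (auto simp: \<tau>_def fun_eq_iff Transposition.transpose_def)
  have "shapley n (sorted_weights n x) k Q = shapley n (x \<circ> \<sigma>) k Q"
    by (rule shapley_cong) (use assms \<sigma> in auto)
  also have "\<dots> = shapley n (x \<circ> \<tau>) (\<sigma> k) Q" by (simp add: shapley_permute[OF \<sigma>(1)] x\<tau>)
  also have "\<dots> = shapley n x i Q" by (simp only: shapley_permute[OF \<tau>]) (simp add: \<tau>_def)
  finally show ?thesis .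
qed

lemma sorted_weights_first:
  assumes i: "i < n" and le: "\<And>j. j < n \<Longrightarrow> x i \<le> x j"
  shows "sorted_weights n x 0 = x i"
proof -
  obtain \<sigma> where \<sigma>: "\<sigma> permutes {..<n}" "\<And>j. j < n \<Longrightarrow> sorted_weights n x j = x (\<sigma> j)"
    by (rule sorted_weights_permutation[of n x]) blast
  obtain j where j: "j < n" "\<sigma> j = i" using permutes_image[OF \<sigma>(1)] i by (metis imageE lessThan_iff)
  have "sorted_weights n x 0 \<le> sorted_weights n x j"
    unfolding sorted_weights_def using j by (intro sorted_nth_mono) auto
  moreover have "x i \<le> sorted_weights n x 0"
    using \<sigma>(2)[of 0] permutes_in_image[OF \<sigma>(1), of 0] i le by auto
  ultimately show ?thesis using \<sigma>(2) j by auto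
qed

lemma sorted_weights_last:
  assumes i: "i < n" and le: "\<And>j. j < n \<Longrightarrow> x j \<le> x i"
  shows "sorted_weights n x (n - 1) = x i"
proof -
  obtain \<sigma> where \<sigma>: "\<sigma> permutes {..<n}" "\<And>j. j < n \<Longrightarrow> sorted_weights n x j = x (\<sigma> j)"
    by (rule sorted_weights_permutation[of n x]) blast
  obtain j where j: "j < n" "\<sigma> j = i" using permutes_image[OF \<sigma>(1)] i by (metis imageE lessThan_iff)
  have "sorted_weights n x j \<le> sorted_weights n x (n - 1)"
    unfolding sorted_weights_def using j by (intro sorted_nth_mono) auto
  moreover have "sorted_weights n x (n - 1) \<le> x i"
    using \<sigma>(2)[of "n - 1"] permutes_in_image[OF \<sigma>(1), of "n - 1"] i le by auto
  ultimately show ?thesis using \<sigma>(2) j by auto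
qed

text \<open>The least maximiser is the witness. Of two candidates i' < i, the rule for i gives x i'
  < x i and the rule for i' gives x i \<le> x i'.\<close>

lemma ex1_first_argmax:
  fixes x :: "nat \<Rightarrow> real"
  assumes "0 < n"
  shows "\<exists>!i. i < n \<and> (\<forall>j\<in>{..<n} - {i}. if j < i then x j < x i else x j \<le> x i)"
proof -
  let ?P = "\<lambda>i. i < n \<and> (\<forall>j<n. x j \<le> x i)"
  have "Max (x ` {..<n}) \<in> x ` {..<n}" using assms by (intro Max_in) auto
  then obtain m where "m < n" "x m = Max (x ` {..<n})" by auto
  then have "?P m" by auto
  then have *: "?P (LEAST i. ?P i)" by (rule LeastI)
  have "x j < x (LEAST i. ?P i)" if "j < (LEAST i. ?P i)" for j
  proof (rule ccontr)
    assume "\<not> x j < x (LEAST i. ?P i)"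
    then have "?P j" using * that by (auto intro: order_trans)
    then show False using not_less_Least[OF that] by simp
  qed
  then have "(LEAST i. ?P i) < n \<and> (\<forall>j\<in>{..<n} - {LEAST i. ?P i}.
      if j < (LEAST i. ?P i) then x j < x (LEAST i. ?P i) else x j \<le> x (LEAST i. ?P i))"
    using * by auto
  moreover have "i = i'"
    if "i < n" "\<forall>j\<in>{..<n} - {i}. if j < i then x j < x i else x j \<le> x i"
       "i' < n" "\<forall>j\<in>{..<n} - {i'}. if j < i' then x j < x i' else x j \<le> x i'" for i i'
  proof (rule ccontr)
    assume "i \<noteq> i'"
    moreover have "if i' < i then x i' < x i else x i' \<le> x i"
      using bspec[OF that(2), of i'] that(3) \<open>i \<noteq> i'\<close> by auto
    moreover have "if i < i' then x i < x i' else x i \<le> x i'"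
      using bspec[OF that(4), of i] that(1) \<open>i \<noteq> i'\<close> by auto
    ultimately show False by (auto split: if_splits)
  qed
  ultimately show ?thesis by blast
qed

section \<open>Conditioning on the weight of the selected agent\<close>

text \<open>The indicator discards \<open>y \<le> 0\<close>, a null set on which measurability in \<open>y\<close> would need a separate argument.\<close>

definition pivot_mass :: "(real \<Rightarrow> real set) \<Rightarrow> nat \<Rightarrow> real \<Rightarrow> nat \<Rightarrow> real \<Rightarrow> real" where
  "pivot_mass B n Q k y = indicator {0<..} y *
     (measure expX (B y) ^ (n - 1 - k) * (pcdf (B y) k Q - pcdf (B y) k (Q - y)))"

text \<open>The relation \<open>R i j\<close> breaks ties by index, so that exactly one agent is selected for every sample.\<close>

locale selection =
  fixes R :: "nat \<Rightarrow> nat \<Rightarrow> real \<Rightarrow> real \<Rightarrow> bool" and B :: "real \<Rightarrow> real set" and n k :: nat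
  assumes meas [measurable]: "\<And>i j. Measurable.pred (borel \<Otimes>\<^sub>M borel) (\<lambda>z. R i j (fst z) (snd z))"
    and B [measurable]: "\<And>y. B y \<in> sets borel"
    and RB: "\<And>i j y. AE s in expX. R i j y s \<longleftrightarrow> s \<in> B y"
    and unique: "\<And>x. \<exists>!i. i < n \<and> (\<forall>j\<in>{..<n} - {i}. R i j (x i) (x j))"
    and k: "k < n"
    and rank: "\<And>x i. i < n \<Longrightarrow> \<forall>j\<in>{..<n} - {i}. R i j (x i) (x j) \<Longrightarrow> sorted_weights n x k = x i"
begin

lemma pivot_mass_bounds: "0 \<le> pivot_mass B n Q m y" "pivot_mass B n Q m y \<le> 1"
proof -
  note P = pcdf_basic[OF B, of y m]
  have T: "0 \<le> measure expX (B y) ^ l" "measure expX (B y) ^ l \<le> 1" for l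
    by (auto intro: power_le_one)
  have "0 \<le> pcdf (B y) m Q - pcdf (B y) m (Q - y)" if "0 < y"
    using P that by (auto intro: monoD)
  moreover have "pcdf (B y) m Q - pcdf (B y) m (Q - y) \<le> 1"
    using P T(2)[of m] by (smt (verit))
  ultimately show "0 \<le> pivot_mass B n Q m y" "pivot_mass B n Q m y \<le> 1"
    using T[of "n - 1 - m"]
    by (auto simp: pivot_mass_def indicator_def intro!: mult_le_one)
qed

lemma measurable_event:
  assumes i: "i < n" and A: "A \<subseteq> {..<n}"
  shows "Measurable.pred (sample n) (\<lambda>x. (\<forall>j\<in>{..<n} - {i}. R i j (x i) (x j))
     \<and> Q - x i \<le> (\<Sum>j\<in>A. x j) \<and> (\<Sum>j\<in>A. x j) < Q)"
proof -
  have c: "(\<lambda>x. x j) \<in> borel_measurable (sample n)" if "j < n" for j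
    unfolding sample_def by measurable (use that in auto)
  have "Measurable.pred (sample n) (\<lambda>x. R i j (x i) (x j))" if "j \<in> {..<n} - {i}" for j
    using measurable_compose[OF _ meas, of "\<lambda>x. (x i, x j)" "sample n" i j] c[of i] c[of j] i that by simp
  moreover define s where "s = (\<lambda>x :: nat \<Rightarrow> real. \<Sum>j\<in>A. x j)"
  have s: "s \<in> borel_measurable (sample n)"
    unfolding s_def using A c by (intro borel_measurable_sum) auto
  have "Measurable.pred (sample n) (\<lambda>x. Q - x i \<le> s x)" "Measurable.pred (sample n) (\<lambda>x. s x < Q)"
    unfolding pred_def
    by (intro borel_measurable_le borel_measurable_less borel_measurable_diff borel_measurable_const c[OF i] s)+
  ultimately show ?thesis unfolding s_def by (intro pred_intros_logic pred_intros_finite) auto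
qed

text \<open>The coordinate of agent \<open>i\<close> is integrated last. For a fixed value y of it,
  the pivotal event is the difference of the events that the predecessors sum to less than
  \<open>Q\<close> and to less than \<open>Q - y\<close>; \<open>nn_integral_PiM_pcdf\<close>
  evaluates both, and only the number of predecessors survives.\<close>

lemma nn_integral_pivotal:
  assumes i: "i < n" and A: "A \<subseteq> {..<n} - {i}"
  shows "(\<lambda>y. pivot_mass B n Q (card A) y) \<in> borel_measurable borel"
    and "(\<integral>\<^sup>+x. (if (\<forall>j\<in>{..<n} - {i}. R i j (x i) (x j)) \<and> Q - x i \<le> (\<Sum>j\<in>A. x j) \<and> (\<Sum>j\<in>A. x j) < Q
        then 1 else 0) \<partial>sample n) = (\<integral>\<^sup>+y. ennreal (pivot_mass B n Q (card A) y) \<partial>expX)"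
proof -
  interpret PF: product_sigma_finite "\<lambda>_::nat. expX" by unfold_locales
  let ?J = "{..<n} - {i}"
  let ?PM = "PiM ?J (\<lambda>_. expX)"
  let ?ind = "\<lambda>y t x. if (\<forall>j\<in>?J. R i j y (x j)) \<and> (\<Sum>j\<in>A. x j) < t then 1 else 0 :: ennreal"
  let ?h = "\<lambda>y x. if (\<forall>j\<in>?J. R i j y (x j)) \<and> Q - y \<le> (\<Sum>j\<in>A. x j) \<and> (\<Sum>j\<in>A. x j) < Q then 1 else 0 :: ennreal"
  have n: "insert i ?J = {..<n}" using i by auto
  have card: "card (?J - A) = n - 1 - card A"
    using A i by (simp add: card_Diff_subset finite_subset)
  have A1: "A \<subseteq> insert i ?J" using A by auto
  have [measurable]: "Measurable.pred borel (R i j y)" for j y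
  proof -
    have "Measurable.pred borel (\<lambda>s. R i j (fst (y, s)) (snd (y, s)))"
      by (rule measurable_compose[OF _ meas]) measurable
    then show ?thesis by simp
  qed
  have [measurable]: "(\<lambda>z. ?ind (fst z) (c (fst z)) (snd z)) \<in> borel_measurable (borel \<Otimes>\<^sub>M ?PM)"
    if [measurable]: "c \<in> borel_measurable borel" for c
  proof -
    have [measurable]: "Measurable.pred (borel \<Otimes>\<^sub>M ?PM) (\<lambda>z. R i j (fst z) (snd z j))" if "j \<in> ?J" for j
      using that by (intro measurable_compose[OF _ meas, where f = "\<lambda>z. (fst z, snd z j)", simplified]) measurable
    show ?thesis using subsetD[OF A] by measurable
  qed
  have PM: "prob_space ?PM" by (intro prob_space_PiM) unfold_locales
  then have "sigma_finite_measure ?PM" by (simp add: prob_space_imp_sigma_finite)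
  then have meas_y: "(\<lambda>y. \<integral>\<^sup>+x. ?ind y (c y) x \<partial>?PM) \<in> borel_measurable borel"
    if [measurable]: "c \<in> borel_measurable borel" for c :: "real \<Rightarrow> real"
    by (rule sigma_finite_measure.borel_measurable_nn_integral) (simp add: case_prod_beta, measurable)
  have inner: "(\<integral>\<^sup>+x. ?ind y t x \<partial>?PM) = ennreal (measure expX (B y) ^ (n - 1 - card A) * pcdf (B y) (card A) t)" for y t
    unfolding card[symmetric] by (rule nn_integral_PiM_pcdf) (use A RB in auto)
  have val: "(\<integral>\<^sup>+x. ?h y x \<partial>?PM) = ennreal (pivot_mass B n Q (card A) y)" if y: "0 < y" for y
  proof -
    have sec: "?ind y t \<in> borel_measurable ?PM" for t
      using subsetD[OF A] by measurable
    have "?h y \<in> borel_measurable ?PM" using subsetD[OF A] by measurable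
    then have "(\<integral>\<^sup>+x. ?ind y (Q - y) x + ?h y x \<partial>?PM) = (\<integral>\<^sup>+x. ?ind y (Q - y) x \<partial>?PM) + (\<integral>\<^sup>+x. ?h y x \<partial>?PM)"
      by (intro nn_integral_add sec)
    moreover have "(\<integral>\<^sup>+x. ?ind y (Q - y) x + ?h y x \<partial>?PM) = (\<integral>\<^sup>+x. ?ind y Q x \<partial>?PM)"
      by (rule nn_integral_cong) (use y in auto)
    ultimately have "(\<integral>\<^sup>+x. ?h y x \<partial>?PM) = (\<integral>\<^sup>+x. ?ind y Q x \<partial>?PM) - (\<integral>\<^sup>+x. ?ind y (Q - y) x \<partial>?PM)"
      using ennreal_add_diff_cancel_left[OF ennreal_neq_top] unfolding inner by simp
    also have "\<dots> = ennreal (pivot_mass B n Q (card A) y)"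
      unfolding inner using y pcdf_basic[OF B, of y "card A"]
      by (subst ennreal_minus) (auto simp: pivot_mass_def right_diff_distrib)
    finally show ?thesis .
  qed
  \<comment> \<open>Measurability of \<open>pivot_mass\<close> in \<open>y\<close> is read off from
    Fubini's theorem, as a difference of inner integrals; the recursion for
    \<open>pcdf (B y)\<close> itself is not analysed in \<open>y\<close>.\<close>
  have "(\<lambda>y. indicator {0<..} y * (enn2real (\<integral>\<^sup>+x. ?ind y Q x \<partial>?PM) - enn2real (\<integral>\<^sup>+x. ?ind y (Q - y) x \<partial>?PM)))
      \<in> borel_measurable borel"
    by (intro borel_measurable_times borel_measurable_diff borel_measurable_indicator
        measurable_compose[OF meas_y borel_measurable_enn2real]) auto
  also have "(\<lambda>y. indicator {0<..} y * (enn2real (\<integral>\<^sup>+x. ?ind y Q x \<partial>?PM) - enn2real (\<integral>\<^sup>+x. ?ind y (Q - y) x \<partial>?PM)))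
      = (\<lambda>y. pivot_mass B n Q (card A) y)"
    unfolding inner using pcdf_basic[OF B] by (auto simp: fun_eq_iff pivot_mass_def right_diff_distrib)
  finally show "(\<lambda>y. pivot_mass B n Q (card A) y) \<in> borel_measurable borel" .
  have upd: "(\<Sum>j\<in>A. (x(i := y)) j) = (\<Sum>j\<in>A. x j)"
    "(\<forall>j\<in>?J. R i j ((x(i := y)) i) ((x(i := y)) j)) \<longleftrightarrow> (\<forall>j\<in>?J. R i j y (x j))" for x and y :: real
    using A by (auto intro!: sum.cong)
  have "(\<lambda>x. if (\<forall>j\<in>?J. R i j (x i) (x j)) \<and> Q - x i \<le> (\<Sum>j\<in>A. x j) \<and> (\<Sum>j\<in>A. x j) < Q then 1 else 0 :: ennreal)
     \<in> borel_measurable (PiM (insert i ?J) (\<lambda>_. expX))"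
    using measurable_event[OF i A1[unfolded n], of Q] unfolding sample_def n by measurable
  note ins = PF.product_nn_integral_insert_rev[OF _ _ this]
  have "(\<integral>\<^sup>+x. (if (\<forall>j\<in>?J. R i j (x i) (x j)) \<and> Q - x i \<le> (\<Sum>j\<in>A. x j) \<and> (\<Sum>j\<in>A. x j) < Q
        then 1 else 0) \<partial>sample n) = (\<integral>\<^sup>+y. (\<integral>\<^sup>+x. ?h y x \<partial>?PM) \<partial>expX)"
    using ins by (simp only: upd n sample_def[symmetric]) simp
  also have "\<dots> = (\<integral>\<^sup>+y. ennreal (pivot_mass B n Q (card A) y) \<partial>expX)"
    by (rule nn_integral_cong_AE) (use AE_expX_pos in eventually_elim, rule val)
  finally show "(\<integral>\<^sup>+x. (if (\<forall>j\<in>?J. R i j (x i) (x j)) \<and> Q - x i \<le> (\<Sum>j\<in>A. x j) \<and> (\<Sum>j\<in>A. x j) < Q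
        then 1 else 0) \<partial>sample n) = (\<integral>\<^sup>+y. ennreal (pivot_mass B n Q (card A) y) \<partial>expX)" .
qed

text \<open>For a fixed ordering \<open>p\<close> the term of agent \<open>i\<close> depends only on
  its position \<open>p i\<close>, so summing over the agents visits each number of predecessors m <
  n exactly once. The result is the same for all \<open>fact n\<close> orderings, which cancels the
  normalisation and leaves no factor 1 / n.\<close>

lemma exp_shapley_eq:
  shows "integrable expX (\<lambda>y. \<Sum>m<n. pivot_mass B n Q m y)"
    and "exp_shapley n k Q = (\<integral>y. (\<Sum>m<n. pivot_mass B n Q m y) \<partial>expX)"
proof -
  let ?J = "\<lambda>i. {..<n} - {i}"
  let ?sel = "\<lambda>i x. \<forall>j\<in>?J i. R i j (x i) (x j)"
  let ?perms = "{p. p permutes {..<n}}"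
  define c where "c m = (\<integral>y. pivot_mass B n Q m y \<partial>expX)" for m
  have fin: "finite ?perms" by (rule finite_permutations) simp
  \<comment> \<open>Only the size of the predecessor set enters, so \<open>{..<m}\<close> before
    agent \<open>n - 1\<close> represents all sets of size \<open>m\<close>.\<close>
  have m: "(\<lambda>y. pivot_mass B n Q m y) \<in> borel_measurable borel" if "m < n" for m
    using nn_integral_pivotal(1)[of "n - 1" "{..<m}" Q] that by force
  have int: "integrable expX (\<lambda>y. pivot_mass B n Q m y)" if "m < n" for m
    by (rule expX_integrable_bounded[OF m[OF that], where B = 1]) (use pivot_mass_bounds[of Q m] in auto)
  then show "integrable expX (\<lambda>y. \<Sum>m<n. pivot_mass B n Q m y)" by auto
  define f where "f p i = (\<lambda>x. of_bool (?sel i x \<and> pivotal n Q p i x) :: real)" for p i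
  have f_meas: "f p i \<in> borel_measurable (sample n)" if "i < n" for p i
  proof -
    have "{j. j < n \<and> p j < p i} \<subseteq> {..<n}" by auto
    from measurable_event[OF that this, of Q] show ?thesis
      unfolding f_def pivotal_def of_bool_def pred_def by (intro measurable_If) auto
  qed
  interpret S: prob_space "sample n"
    unfolding sample_def by (intro prob_space_PiM) unfold_locales
  have f_int: "integrable (sample n) (f p i)" if "i < n" for p i
    by (rule S.integrable_const_bound[where B = 1]) (use f_meas[OF that] in \<open>auto simp: f_def\<close>)
  have f_val: "(\<integral>x. f p i x \<partial>sample n) = c (p i)" if p: "p permutes {..<n}" and i: "i < n" for p i
  proof -
    let ?A = "{j. j < n \<and> p j < p i}"
    have "p i < n" using permutes_in_image[OF p, of i] i by simp
    have "p ` ?A = {..<p i}"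
    proof
      show "{..<p i} \<subseteq> p ` ?A"
      proof
        fix m assume m: "m \<in> {..<p i}"
        then have "m \<in> p ` {..<n}" using permutes_image[OF p] \<open>p i < n\<close> by auto
        then show "m \<in> p ` ?A" using m by auto
      qed
    qed auto
    then have card: "card ?A = p i"
      using card_image[of p ?A] permutes_inj_on[OF p, of ?A] by simp
    have "(\<integral>x. f p i x \<partial>sample n) = enn2real (\<integral>\<^sup>+x. ennreal (f p i x) \<partial>sample n)"
      by (rule integral_eq_nn_integral) (use f_meas[OF i] in \<open>auto simp: f_def\<close>)
    also have "(\<integral>\<^sup>+x. ennreal (f p i x) \<partial>sample n) = (\<integral>\<^sup>+x. (if ?sel i x \<and> Q - x i \<le> (\<Sum>j\<in>?A. x j)
        \<and> (\<Sum>j\<in>?A. x j) < Q then 1 else 0) \<partial>sample n)"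
      by (intro nn_integral_cong) (auto simp: f_def pivotal_def)
    also have "\<dots> = (\<integral>\<^sup>+y. ennreal (pivot_mass B n Q (p i) y) \<partial>expX)"
      using nn_integral_pivotal(2)[OF i, of ?A Q] by (auto simp: card)
    also have "enn2real \<dots> = c (p i)"
      unfolding c_def
      by (rule integral_eq_nn_integral[symmetric]) (use m[OF \<open>p i < n\<close>] pivot_mass_bounds in auto)
    finally show ?thesis .
  qed
  \<comment> \<open>Exactly one \<open>i\<close> is selected in each sample, so the inner sum
    reduces to a single term and the identity holds pointwise, ties included.\<close>
  have "shapley n (sorted_weights n x) k Q = (\<Sum>p\<in>?perms. \<Sum>i<n. f p i x) / fact n" for x
  proof -
    define S where "S i \<longleftrightarrow> i < n \<and> ?sel i x" for i
    have ex1: "\<exists>!i. S i" unfolding S_def by (rule unique)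
    then obtain i where S: "S i" by blast
    then have i: "i < n" "?sel i x" by (simp_all add: S_def)
    have u: "i' = i" if "S i'" for i'
      using ex1 that S by (metis (no_types))
    have "(\<Sum>i'<n. f p i' x) = of_bool (pivotal n Q p i x)" for p
    proof -
      have "(\<Sum>i'<n. f p i' x) = (\<Sum>i'<n. if i' = i then of_bool (pivotal n Q p i x) else 0)"
      proof (rule sum.cong[OF refl])
        fix i' assume i': "i' \<in> {..<n}"
        show "f p i' x = (if i' = i then of_bool (pivotal n Q p i x) else 0)"
        proof (cases "i' = i")
          case True
          then show ?thesis using i(2) by (simp add: f_def)
        next
          case False
          then have "\<not> S i'" using u by blast
          then have "\<not> ?sel i' x" using i' unfolding S_def by blast
          then show ?thesis using False unfolding f_def by simp
        qed
      qed
      then show ?thesis using i(1) by simp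
    qed
    then show ?thesis
      unfolding shapley_sorted_weights[OF k i(1) rank[OF i]] by (simp add: shapley_eq_sum)
  qed
  then have "exp_shapley n k Q = (\<integral>x. (\<Sum>p\<in>?perms. \<Sum>i<n. f p i x) / fact n \<partial>sample n)"
    by (simp add: exp_shapley_def)
  also have "\<dots> = (\<Sum>p\<in>?perms. \<Sum>i<n. \<integral>x. f p i x \<partial>sample n) / fact n"
  proof -
    have "(\<integral>x. (\<Sum>p\<in>?perms. \<Sum>i<n. f p i x) \<partial>sample n) = (\<Sum>p\<in>?perms. \<integral>x. (\<Sum>i<n. f p i x) \<partial>sample n)"
      by (intro Bochner_Integration.integral_sum Bochner_Integration.integrable_sum f_int) simp
    also have "\<dots> = (\<Sum>p\<in>?perms. \<Sum>i<n. \<integral>x. f p i x \<partial>sample n)"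
      by (intro sum.cong refl Bochner_Integration.integral_sum f_int) simp
    finally show ?thesis by simp
  qed
  also have "(\<Sum>p\<in>?perms. \<Sum>i<n. \<integral>x. f p i x \<partial>sample n) = (\<Sum>p\<in>?perms. \<Sum>m<n. c m)"
  proof (rule sum.cong[OF refl])
    fix p assume "p \<in> ?perms"
    then have p: "p permutes {..<n}" by simp
    have "(\<Sum>i<n. \<integral>x. f p i x \<partial>sample n) = (\<Sum>i<n. c (p i))"
      by (rule sum.cong) (simp_all add: f_val[OF p])
    also have "\<dots> = (\<Sum>m<n. c m)"
      unfolding sum.permute[OF p, of c] by simp
    finally show "(\<Sum>i<n. \<integral>x. f p i x \<partial>sample n) = (\<Sum>m<n. c m)" .
  qed
  also have "\<dots> / fact n = (\<Sum>m<n. c m)"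
    using card_permutations[of "{..<n}" n] by simp
  also have "\<dots> = (\<integral>y. (\<Sum>m<n. pivot_mass B n Q m y) \<partial>expX)"
    unfolding c_def by (rule Bochner_Integration.integral_sum[symmetric]) (use int in auto)
  finally show "exp_shapley n k Q = (\<integral>y. (\<Sum>m<n. pivot_mass B n Q m y) \<partial>expX)" .
qed

end

section \<open>The two selection rules\<close>

lemma selection_max:
  assumes "0 < n"
  shows "selection (\<lambda>i j y s. if j < i then s < y else s \<le> y) (\<lambda>y. {..y}) n (n - 1)"
proof
  show "AE s in expX. (if j < i then s < y else s \<le> y) \<longleftrightarrow> s \<in> {..y}" for i j :: nat and y :: real
    using AE_expX_neq[of y] by eventually_elim auto
  show "\<exists>!i. i < n \<and> (\<forall>j\<in>{..<n} - {i}. if j < i then x j < x i else x j \<le> x i)" for x :: "nat \<Rightarrow> real"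
    by (rule ex1_first_argmax[OF assms])
  show "sorted_weights n x (n - 1) = x i"
    if "i < n" "\<forall>j\<in>{..<n} - {i}. if j < i then x j < x i else x j \<le> x i" for x i
  proof (rule sorted_weights_last[OF that(1)])
    fix j assume "j < n"
    then show "x j \<le> x i" using bspec[OF that(2), of j] by (cases "j = i"; cases "j < i") auto
  qed
qed (use assms in auto)

lemma selection_min:
  assumes "0 < n"
  shows "selection (\<lambda>i j y s. if j < i then y < s else y \<le> s) (\<lambda>y. {y<..}) n 0"
proof
  show "AE s in expX. (if j < i then y < s else y \<le> s) \<longleftrightarrow> s \<in> {y<..}" for i j :: nat and y :: real
    using AE_expX_neq[of y] by eventually_elim auto
  \<comment> \<open>A first minimiser is a first maximiser of the negated weights.\<close>
  show "\<exists>!i. i < n \<and> (\<forall>j\<in>{..<n} - {i}. if j < i then x i < x j else x i \<le> x j)" for x :: "nat \<Rightarrow> real"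
    using ex1_first_argmax[OF assms, of "\<lambda>j. - x j"] by (simp only: neg_less_iff_less neg_le_iff_le)
  show "sorted_weights n x 0 = x i"
    if "i < n" "\<forall>j\<in>{..<n} - {i}. if j < i then x i < x j else x i \<le> x j" for x i
  proof (rule sorted_weights_first[OF that(1)])
    fix j assume "j < n"
    then show "x i \<le> x j" using bspec[OF that(2), of j] by (cases "j = i"; cases "j < i") auto
  qed
qed (use assms in auto)

section \<open>Error bounds for the extreme agents\<close>

text \<open>The agents after the extreme one contribute P(B)^(n-1-m), and normalising m steps takes
  P(B)^m. The product does not depend on m, so the sum over positions is the window count
  \<open>W\<close>.\<close>

lemma (in renewal) sum_pivot_mass:
  "(\<Sum>m<n. T ^ (n - 1 - m) * (pcdf B m Q - pcdf B m (Q - y))) = T ^ (n - 1) * W n Q"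
proof -
  have "T ^ (n - 1 - m) * (pcdf B m Q - pcdf B m (Q - y)) = T ^ (n - 1) * (G m Q - G m (Q - y))" if "m < n" for m
  proof -
    have "T ^ (n - 1) = T ^ (n - 1 - m) * T ^ m" using that by (simp flip: power_add)
    then show ?thesis using T by (simp add: G_def diff_divide_distrib[symmetric])
  qed
  then show ?thesis
    unfolding W_def U_def sum_subtractf[symmetric] sum_distrib_left by (intro sum.cong) auto
qed

text \<open>Integrability of the limiting integrand \<open>g\<close> is a conclusion:
  \<open>g\<close> lies within the integrable \<open>E\<close> of the integrable \<open>V\<close>.
  Closeness at positive \<open>y\<close> suffices, the rest being a null set.\<close>

lemma expX_integral_close:
  fixes V g E :: "real \<Rightarrow> real"
  assumes "integrable expX V" "g \<in> borel_measurable borel" "integrable expX E"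
    and close: "\<And>y. 0 < y \<Longrightarrow> \<bar>V y - g y\<bar> \<le> E y"
  shows "integrable expX g" "\<bar>(\<integral>y. V y \<partial>expX) - (\<integral>y. g y \<partial>expX)\<bar> \<le> (\<integral>y. E y \<partial>expX)"
proof -
  have [measurable]: "V \<in> borel_measurable borel" "E \<in> borel_measurable borel" "g \<in> borel_measurable borel"
    using assms(1-3) borel_measurable_integrable[of expX V] borel_measurable_integrable[of expX E] by auto
  have D: "integrable expX (\<lambda>y. V y - g y)"
  proof (rule Bochner_Integration.integrable_bound[OF assms(3)])
    show "AE y in expX. norm (V y - g y) \<le> norm (E y)"
      using AE_expX_pos by eventually_elim (use close in force)
  qed simp
  show g: "integrable expX g"
    using Bochner_Integration.integrable_diff[OF assms(1) D] by simp
  have "\<bar>(\<integral>y. V y \<partial>expX) - (\<integral>y. g y \<partial>expX)\<bar> = \<bar>\<integral>y. V y - g y \<partial>expX\<bar>"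
    using assms(1) g by simp
  also have "\<dots> \<le> (\<integral>y. \<bar>V y - g y\<bar> \<partial>expX)" by (rule integral_abs_bound)
  also have "\<dots> \<le> (\<integral>y. E y \<partial>expX)"
  proof (rule integral_mono_AE)
    show "integrable expX (\<lambda>y. \<bar>V y - g y\<bar>)" using assms(1) g by simp
    show "AE y in expX. \<bar>V y - g y\<bar> \<le> E y"
      using AE_expX_pos by eventually_elim (rule close)
  qed (rule assms(3))
  finally show "\<bar>(\<integral>y. V y \<partial>expX) - (\<integral>y. g y \<partial>expX)\<bar> \<le> (\<integral>y. E y \<partial>expX)" .
qed

lemma LBINT_eq_expX:
  fixes f :: "real \<Rightarrow> real"
  assumes "f \<in> borel_measurable borel"
  shows "(LBINT x:{0<..}. f x) = (\<integral>x. exp x * f x \<partial>expX)"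
  using expX_integral[of "\<lambda>x. exp x * f x"] assms by (simp flip: exp_add mult.assoc)

lemma exp_minus_one_le: "exp y - 1 \<le> y * exp y" for y :: real
proof -
  have "1 - y \<le> exp (- y)" using exp_ge_add_one_self[of "- y"] by simp
  then have "(1 - y) * exp y \<le> exp (- y) * exp y" by (intro mult_right_mono) auto
  then show ?thesis by (simp add: algebra_simps flip: exp_add)
qed

lemma exp_quadratic:
  fixes y :: real
  assumes "0 < y"
  shows "y\<^sup>2 / 2 \<le> exp y - (1 + y)" "0 < exp y - (1 + y)"
proof -
  show *: "y\<^sup>2 / 2 \<le> exp y - (1 + y)" using exp_lower_Taylor_quadratic[of y] assms by simp
  have "0 < y\<^sup>2 / 2" using assms by simp
  then show "0 < exp y - (1 + y)" using * by linarith
qed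

text \<open>The range of \<open>y\<close> is split at \<open>M\<^sub>0\<close>. Above it the
  contraction applies, and passing from \<open>pcdf\<close> to \<open>G n\<close> costs at most
  \<open>exp (\<epsilon>\<^sup>2 / 8) ^ n\<close>, half of the Chernoff exponent. Below it
  \<open>r.T ^ (n - 1)\<close> is at most \<open>(1 - exp (- M\<^sub>0)) ^ (n - 1)\<close>, and
  crude bounds on \<open>W\<close> and \<open>mass\<close> suffice.\<close>

lemma max_close:
  fixes y \<epsilon> Q M\<^sub>0 :: real and n :: nat
  assumes y: "0 < y" and n: "0 < n" and Q: "0 < Q" "Q \<le> (1 - \<epsilon>) * n" and \<epsilon>: "0 < \<epsilon>" "\<epsilon> \<le> 1"
    and M\<^sub>0: "\<And>y. M\<^sub>0 \<le> y \<Longrightarrow> y / (exp y - 1) \<le> 1 / 2 \<and> y / (exp y - 1) \<le> exp (- y / 2)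
        \<and> 1 / (1 - exp (- y)) \<le> exp (\<epsilon>\<^sup>2 / 8)" "0 < M\<^sub>0"
  shows "\<bar>(\<Sum>m<n. pivot_mass (\<lambda>y. {..y}) n Q m y)
          - exp y * ((1 - exp (- y)) ^ n * (y / (exp y - (1 + y))))\<bar>
     \<le> (1 - exp (- M\<^sub>0)) ^ (n - 1) * (real n + 2 * exp M\<^sub>0) + (real n + 8) * exp (- Q / 2) * exp (3 / 4 * y)
        + 2 * (1 + Q) * exp (- real n * \<epsilon>\<^sup>2 / 8)" (is "\<bar>?V - ?g\<bar> \<le> ?a + ?b + ?c")
proof -
  interpret r: renewal "{..y}" y 1 "- exp (- y)" by (rule renewal_atMost[OF y])
  have T: "r.T = 1 - exp (- y)" by (simp add: r.T_def)
  have e1: "0 < exp y - 1" using y by simp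
  have d: "r.d = 1 / (exp y - 1)"
    unfolding r.d_def T using e1 by (simp add: exp_minus field_simps)
  have V: "?V = r.T ^ (n - 1) * r.W n Q"
    unfolding r.sum_pivot_mass[symmetric] pivot_mass_def using y r.T_eq r.T_def by simp
  note pos = exp_quadratic(2)[OF y]
  have mass: "r.mass = y * (exp y - 1) / (exp y - (1 + y))"
    unfolding r.mass_def d using pos e1 by (simp add: field_simps)
  have g: "?g = r.T ^ (n - 1) * r.mass"
  proof -
    have "exp y * (1 - exp (- y)) = exp y - 1" by (simp add: algebra_simps flip: exp_add)
    moreover have "(1 - exp (- y)) ^ n = (1 - exp (- y)) * (1 - exp (- y)) ^ (n - 1)"
      using n by (cases n) auto
    ultimately show ?thesis unfolding mass T by simp
  qed
  have abc: "0 \<le> ?a" "0 \<le> ?b" "0 \<le> ?c" using M\<^sub>0(2) Q by auto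
  have Vg: "\<bar>?V - ?g\<bar> = r.T ^ (n - 1) * \<bar>r.W n Q - r.mass\<bar>"
    using r.T unfolding V g by (simp add: abs_mult flip: right_diff_distrib)
  show ?thesis
  proof (cases "M\<^sub>0 \<le> y")
    case True
    note h = M\<^sub>0(1)[OF True]
    have dy: "\<bar>r.d\<bar> * y = y / (exp y - 1)" using e1 by (simp add: d)
    have "\<bar>r.W n Q - r.mass\<bar> \<le> (real n + 2 * y) * exp ((y - Q) / 2) + 2 * ((1 + Q) * r.G n Q)"
      by (rule r.renewal_error) (use Q h dy in auto)
    \<comment> \<open>The linear factor is absorbed into e^(y/4). With e^(y/2) this makes e^(3y/4),
      still integrable against the exponential density; its mean 4 is the factor in
      \<open>max_error\<close>.\<close>
    moreover have "(real n + 2 * y) * exp ((y - Q) / 2) \<le> ?b"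
    proof -
      have "y / 4 \<le> exp (y / 4)" using exp_ge_add_one_self[of "y / 4"] by linarith
      moreover have "real n * 1 \<le> real n * exp (y / 4)" using y by (intro mult_left_mono) auto
      ultimately have "n + 2 * y \<le> (real n + 8) * exp (y / 4)" by (simp add: algebra_simps)
      then have "(real n + 2 * y) * exp ((y - Q) / 2) \<le> (real n + 8) * exp (y / 4) * exp ((y - Q) / 2)"
        by (intro mult_right_mono) auto
      also have "\<dots> = ?b" unfolding mult.assoc exp_add[symmetric] by (simp add: field_simps)
      finally show ?thesis .
    qed
    moreover have "2 * ((1 + Q) * r.G n Q) \<le> ?c"
    proof -
      have "(\<integral>s. indicator {..y} s * exp (- (\<epsilon> / 2) * s) \<partial>expX) \<le> (\<integral>s. exp (- (\<epsilon> / 2) * s) \<partial>expX)"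
      proof (rule integral_mono_AE)
        show i: "integrable expX (\<lambda>s. exp (- (\<epsilon> / 2) * s))" using \<epsilon> by (intro expX_exp_moment) auto
        show "integrable expX (\<lambda>s. indicator {..y} s * exp (- (\<epsilon> / 2) * s))"
          by (rule Bochner_Integration.integrable_bound[OF i]) (auto simp: indicator_def)
      qed (auto simp: indicator_def)
      also have "\<dots> = 1 / (1 + \<epsilon> / 2)" using expX_exp_moment(2)[of "- (\<epsilon> / 2)"] \<epsilon> by simp
      finally have "pcdf {..y} n Q \<le> exp (\<epsilon> / 2 * Q) * (1 / (1 + \<epsilon> / 2)) ^ n"
        using \<epsilon> by (intro pcdf_laplace_bound) auto
      also have "\<dots> \<le> exp (- real n * \<epsilon>\<^sup>2 / 4)" using \<epsilon> Q by (intro chernoff_exponent) auto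
      finally have p: "pcdf {..y} n Q \<le> exp (- real n * \<epsilon>\<^sup>2 / 4)" .
      have "r.G n Q = pcdf {..y} n Q * (1 / r.T) ^ n" by (simp add: r.G_def power_one_over field_simps)
      also have "\<dots> \<le> exp (- real n * \<epsilon>\<^sup>2 / 4) * exp (\<epsilon>\<^sup>2 / 8) ^ n"
        using p h r.T unfolding T by (intro mult_mono power_mono) auto
      also have "\<dots> = exp (- real n * \<epsilon>\<^sup>2 / 8)"
        unfolding exp_of_nat_mult[symmetric] exp_add[symmetric] by (simp add: field_simps)
      finally show ?thesis unfolding mult.assoc using Q by (intro mult_left_mono) auto
    qed
    ultimately have "\<bar>r.W n Q - r.mass\<bar> \<le> ?b + ?c" by linarith
    moreover have "r.T ^ (n - 1) * \<bar>r.W n Q - r.mass\<bar> \<le> \<bar>r.W n Q - r.mass\<bar>"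
      using r.T r.T_le1 by (intro mult_left_le_one_le power_le_one) auto
    ultimately have "r.T ^ (n - 1) * \<bar>r.W n Q - r.mass\<bar> \<le> ?b + ?c" by (rule order_trans[rotated])
    also have "\<dots> \<le> ?a + (?b + ?c)" using abc(1) by (rule add_increasing) (rule order_refl)
    finally show ?thesis unfolding Vg by (simp only: add.assoc)
  next
    case False
    \<comment> \<open>Although 1 - d y tends to 0 with \<open>y\<close>, the mass stays bounded:
      numerator and denominator both vanish to second order.\<close>
    have "r.mass \<le> y * (y * exp y) / (y\<^sup>2 / 2)"
      unfolding mass using y pos e1 exp_quadratic[OF y] exp_minus_one_le[of y]
      by (intro frac_le mult_left_mono mult_nonneg_nonneg) auto
    also have "\<dots> = 2 * exp y" using y by (simp add: power2_eq_square)
    also have "\<dots> \<le> 2 * exp M\<^sub>0" using False by simp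
    finally have "r.mass \<le> 2 * exp M\<^sub>0" .
    moreover have "0 \<le> r.mass" unfolding mass using y pos e1 by simp
    ultimately have "\<bar>r.W n Q - r.mass\<bar> \<le> n + 2 * exp M\<^sub>0"
      using r.W_bounds[of n Q] by linarith
    then have "r.T ^ (n - 1) * \<bar>r.W n Q - r.mass\<bar> \<le> ?a"
      using r.T False unfolding T by (intro mult_mono power_mono) auto
    then show ?thesis unfolding Vg using abc by linarith
  qed
qed

lemma max_error:
  fixes \<epsilon> Q M\<^sub>0 :: real and n :: nat
  assumes n: "0 < n" and Q: "0 < Q" "Q \<le> (1 - \<epsilon>) * n" and \<epsilon>: "0 < \<epsilon>" "\<epsilon> \<le> 1"
    and M\<^sub>0: "\<And>y. M\<^sub>0 \<le> y \<Longrightarrow> y / (exp y - 1) \<le> 1 / 2 \<and> y / (exp y - 1) \<le> exp (- y / 2)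
        \<and> 1 / (1 - exp (- y)) \<le> exp (\<epsilon>\<^sup>2 / 8)" "0 < M\<^sub>0"
  shows "\<bar>exp_shapley n (n - 1) Q
          - (LBINT x:{0<..}. (1 - exp (- x)) ^ n * (x / (exp x - (1 + x))))\<bar>
     \<le> (1 - exp (- M\<^sub>0)) ^ (n - 1) * (real n + 2 * exp M\<^sub>0) + 4 * (real n + 8) * exp (- Q / 2)
        + 2 * (1 + Q) * exp (- real n * \<epsilon>\<^sup>2 / 8)"
proof -
  interpret S: selection "\<lambda>i j y s. if j < i then s < y else s \<le> y" "\<lambda>y. {..y}" n "n - 1"
    by (rule selection_max[OF n])
  let ?E = "\<lambda>y. (1 - exp (- M\<^sub>0)) ^ (n - 1) * (real n + 2 * exp M\<^sub>0) + (real n + 8) * exp (- Q / 2) * exp (3 / 4 * y)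
        + 2 * (1 + Q) * exp (- real n * \<epsilon>\<^sup>2 / 8)"
  have i: "integrable expX (\<lambda>y. exp (3 / 4 * y))" "(\<integral>y. exp (3 / 4 * y) \<partial>expX) = 4"
    using expX_exp_moment[of "3 / 4"] by simp_all
  have E: "integrable expX ?E" using i by simp
  have "(\<integral>y. ?E y \<partial>expX) = (1 - exp (- M\<^sub>0)) ^ (n - 1) * (real n + 2 * exp M\<^sub>0) + 4 * (real n + 8) * exp (- Q / 2)
        + 2 * (1 + Q) * exp (- real n * \<epsilon>\<^sup>2 / 8)"
    using i expX.prob_space by (simp add: Bochner_Integration.integral_add)
  moreover have "\<bar>(\<integral>y. (\<Sum>m<n. pivot_mass (\<lambda>y. {..y}) n Q m y) \<partial>expX)
      - (\<integral>y. exp y * ((1 - exp (- y)) ^ n * (y / (exp y - (1 + y)))) \<partial>expX)\<bar> \<le> (\<integral>y. ?E y \<partial>expX)"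
  proof (rule expX_integral_close(2)[OF S.exp_shapley_eq(1) _ E])
    show "\<bar>(\<Sum>m<n. pivot_mass (\<lambda>y. {..y}) n Q m y) - exp y * ((1 - exp (- y)) ^ n * (y / (exp y - (1 + y))))\<bar> \<le> ?E y"
      if "0 < y" for y
      by (rule max_close[OF that n Q \<epsilon> M\<^sub>0])
  qed measurable
  moreover have "(LBINT x:{0<..}. (1 - exp (- x)) ^ n * (x / (exp x - (1 + x))))
      = (\<integral>y. exp y * ((1 - exp (- y)) ^ n * (y / (exp y - (1 + y)))) \<partial>expX)"
    by (rule LBINT_eq_expX) measurable
  ultimately show ?thesis unfolding S.exp_shapley_eq(2) by (simp only:)
qed

text \<open>Here \<open>d = - 1\<close>, so \<open>\<bar>d\<bar> * y\<close> equals \<open>y\<close>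
  and the split is at 1/2. A step conditioned on \<open>{y<..}\<close> is \<open>y\<close> plus an
  exponential variable; its Laplace transform is at most the unconditioned one,
  \<open>r.T ^ n\<close> cancels exactly, and the Chernoff bound is uniform in \<open>y\<close>.
  This permits \<open>e\<close> to tend to 0 with n.\<close>

lemma min_close:
  fixes y e Q :: real and n :: nat
  assumes y: "0 < y" and n: "0 < n" and Q: "0 < Q" "Q \<le> (1 - e) * n" and e: "0 \<le> e" "e \<le> 1"
  shows "\<bar>(\<Sum>m<n. pivot_mass (\<lambda>y. {y<..}) n Q m y) - exp y * (exp (- real n * y) * (y / (y + 1)))\<bar>
     \<le> exp (- real (n - 1) / 2) * (real n + 1) + (real n + 1) * 2 * exp (- Q / 2) + 2 * (1 + Q) * exp (- real n * e\<^sup>2 / 4)"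
    (is "\<bar>?V - ?g\<bar> \<le> ?a + ?b + ?c")
proof -
  interpret r: renewal "{y<..}" y 0 "exp (- y)" by (rule renewal_greaterThan[OF y])
  have T: "r.T = exp (- y)" by (simp add: r.T_def)
  have d: "r.d = - 1" unfolding r.d_def T by simp
  have V: "?V = r.T ^ (n - 1) * r.W n Q"
    unfolding r.sum_pivot_mass[symmetric] pivot_mass_def using y r.T_eq r.T_def by simp
  have mass: "r.mass = y / (1 + y)" unfolding r.mass_def d by simp
  have g: "?g = r.T ^ (n - 1) * r.mass"
  proof -
    have "exp y * exp (- real n * y) = exp (- y) ^ (n - 1)"
      using n by (simp add: of_nat_diff algebra_simps flip: exp_of_nat_mult exp_add)
    then show ?thesis unfolding mass T by (simp add: add.commute flip: mult.assoc)
  qed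
  have abc: "0 \<le> ?a" "0 \<le> ?b" "0 \<le> ?c" using Q by auto
  have Vg: "\<bar>?V - ?g\<bar> = r.T ^ (n - 1) * \<bar>r.W n Q - r.mass\<bar>"
    using r.T unfolding V g by (simp add: abs_mult flip: right_diff_distrib)
  show ?thesis
  proof (cases "y \<le> 1 / 2")
    case True
    have "\<bar>r.W n Q - r.mass\<bar> \<le> (real n + 2 * y) * exp ((y - Q) / 2) + 2 * ((1 + Q) * r.G n Q)"
    proof (rule r.renewal_error)
      have "1 - y / 2 \<le> exp (- y / 2)" using exp_ge_add_one_self[of "- y / 2"] by simp
      then show "\<bar>r.d\<bar> * y \<le> exp (- y / 2)" using True y by (simp add: d)
    qed (use Q True d in auto)
    moreover have "(real n + 2 * y) * exp ((y - Q) / 2) \<le> ?b"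
    proof -
      have "exp (y / 2) \<le> 2"
      proof -
        have "exp (y / 2) \<le> exp (1 / 4)" using True by simp
        also have "\<dots> \<le> 2" using exp_bound_half[of "1 / 4 :: real"] by simp
        finally show ?thesis .
      qed
      then have "(real n + 2 * y) * (exp (y / 2) * exp (- Q / 2)) \<le> (real n + 1) * (2 * exp (- Q / 2))"
        using True y by (intro mult_mono) auto
      moreover have "exp ((y - Q) / 2) = exp (y / 2) * exp (- Q / 2)"
        by (simp add: diff_divide_distrib flip: exp_add)
      ultimately show ?thesis by (simp only: mult.assoc)
    qed
    moreover have "2 * ((1 + Q) * r.G n Q) \<le> ?c"
    proof -
      have "(\<integral>s. indicator {y<..} s * exp (- (e / 2) * s) \<partial>expX)
          = exp (- y) * (\<integral>s. exp (- (e / 2) * (y + s)) \<partial>expX)"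
        using y by (intro expX_shift) auto
      also have "(\<integral>s. exp (- (e / 2) * (y + s)) \<partial>expX) = exp (- (e / 2) * y) * (\<integral>s. exp (- (e / 2) * s) \<partial>expX)"
        by (simp only: distrib_left exp_add) simp
      also have "\<dots> = exp (- (e / 2) * y) * (1 / (1 + e / 2))"
        using expX_exp_moment(2)[of "- (e / 2)"] e by simp
      also have "\<dots> \<le> 1 * (1 / (1 + e / 2))"
        using e y by (intro mult_right_mono) auto
      finally have "(\<integral>s. indicator {y<..} s * exp (- (e / 2) * s) \<partial>expX) \<le> r.T * (1 / (1 + e / 2))"
        unfolding T by simp
      then have "pcdf {y<..} n Q \<le> exp (e / 2 * Q) * (r.T * (1 / (1 + e / 2))) ^ n"
        using e by (intro pcdf_laplace_bound) auto
      also have "\<dots> = r.T ^ n * (exp (e / 2 * Q) * (1 / (1 + e / 2)) ^ n)"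
        by (simp only: power_mult_distrib mult_ac)
      also have "\<dots> \<le> r.T ^ n * exp (- real n * e\<^sup>2 / 4)"
        using e Q r.T by (intro mult_left_mono chernoff_exponent) auto
      finally have "r.G n Q \<le> exp (- real n * e\<^sup>2 / 4)"
        unfolding r.G_def using r.T by (simp add: field_simps)
      then show ?thesis unfolding mult.assoc using Q by (intro mult_left_mono) auto
    qed
    ultimately have "\<bar>r.W n Q - r.mass\<bar> \<le> ?b + ?c" by linarith
    moreover have "r.T ^ (n - 1) * \<bar>r.W n Q - r.mass\<bar> \<le> \<bar>r.W n Q - r.mass\<bar>"
      using r.T r.T_le1 by (intro mult_left_le_one_le power_le_one) auto
    ultimately have "r.T ^ (n - 1) * \<bar>r.W n Q - r.mass\<bar> \<le> ?b + ?c" by (rule order_trans[rotated])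
    also have "\<dots> \<le> ?a + (?b + ?c)" using abc(1) by (rule add_increasing) (rule order_refl)
    finally show ?thesis unfolding Vg by (simp only: add.assoc)
  next
    case False
    have "0 \<le> r.mass" "r.mass \<le> 1" unfolding mass using y by auto
    then have "\<bar>r.W n Q - r.mass\<bar> \<le> n + 1"
      using r.W_bounds[of n Q] by linarith
    moreover have "r.T ^ (n - 1) \<le> exp (- real (n - 1) / 2)"
    proof -
      have "r.T ^ (n - 1) = exp (- (real (n - 1) * y))" unfolding T by (simp flip: exp_of_nat_mult)
      moreover have "real (n - 1) * (1 / 2) \<le> real (n - 1) * y" using False by (intro mult_left_mono) auto
      ultimately show ?thesis by simp
    qed
    ultimately have "r.T ^ (n - 1) * \<bar>r.W n Q - r.mass\<bar> \<le> ?a"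
      using r.T by (intro mult_mono) auto
    then show ?thesis unfolding Vg using abc by linarith
  qed
qed

lemma min_error:
  fixes e Q :: real and n :: nat
  assumes n: "0 < n" and Q: "0 < Q" "Q \<le> (1 - e) * n" and e: "0 \<le> e" "e \<le> 1"
  shows "\<bar>exp_shapley n 0 Q - (LBINT x:{0<..}. exp (- real n * x) * (x / (x + 1)))\<bar>
     \<le> exp (- real (n - 1) / 2) * (real n + 1) + (real n + 1) * 2 * exp (- Q / 2) + 2 * (1 + Q) * exp (- real n * e\<^sup>2 / 4)"
proof -
  interpret S: selection "\<lambda>i j y s. if j < i then y < s else y \<le> s" "\<lambda>y. {y<..}" n 0
    by (rule selection_min[OF n])
  let ?E = "exp (- real (n - 1) / 2) * (real n + 1) + (real n + 1) * 2 * exp (- Q / 2) + 2 * (1 + Q) * exp (- real n * e\<^sup>2 / 4)"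
  have E: "integrable expX (\<lambda>y. ?E)" by simp
  have "\<bar>(\<integral>y. (\<Sum>m<n. pivot_mass (\<lambda>y. {y<..}) n Q m y) \<partial>expX)
      - (\<integral>y. exp y * (exp (- real n * y) * (y / (y + 1))) \<partial>expX)\<bar> \<le> (\<integral>y. ?E \<partial>expX)"
  proof (rule expX_integral_close(2)[OF S.exp_shapley_eq(1) _ E])
    show "\<bar>(\<Sum>m<n. pivot_mass (\<lambda>y. {y<..}) n Q m y) - exp y * (exp (- real n * y) * (y / (y + 1)))\<bar> \<le> ?E"
      if "0 < y" for y
      by (rule min_close[OF that n Q e])
  qed measurable
  then show ?thesis using expX.prob_space by (simp add: S.exp_shapley_eq(2) LBINT_eq_expX)
qed

section \<open>Asymptotics of the limiting integrals\<close>

lemma expX_FTC: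
  fixes f F :: "real \<Rightarrow> real"
  assumes [measurable]: "f \<in> borel_measurable borel"
    and deriv: "\<And>x. 0 \<le> x \<Longrightarrow> DERIV F x :> exp (- x) * f x"
    and nonneg: "\<And>x. 0 \<le> x \<Longrightarrow> 0 \<le> f x"
    and lim: "(F \<longlongrightarrow> T) at_top"
  shows "integrable expX f" "(\<integral>x. f x \<partial>expX) = T - F 0"
  using half_line_FTC[of "\<lambda>x. exp (- x) * f x" F T] assms
  by (auto simp: expX_integrable_iff expX_integral)

lemma meanX_eq_1: "meanX = 1"
proof -
  have "((\<lambda>x::real. - (x + 1) * exp (- x)) \<longlongrightarrow> 0) at_top" by real_asymp
  then have "(\<integral>x. x \<partial>expX) = 0 - (- (0 + 1) * exp (- 0))"
    by (intro expX_FTC(2)) (auto intro!: derivative_eq_intros simp: algebra_simps)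
  then show ?thesis by (simp add: meanX_def)
qed

text \<open>n e^(-x) (1 - e^(-x))^(n-1) is the density of the maximum of n independent exponential
  variables, whose mean is the harmonic number.\<close>

lemma expX_max_mean:
  assumes n: "0 < n"
  shows "integrable expX (\<lambda>x. (1 - exp (- x)) ^ (n - 1) * x)"
    "(\<integral>x. (1 - exp (- x)) ^ (n - 1) * x \<partial>expX) = harm n / n"
proof -
  let ?T = "\<lambda>x::real. 1 - exp (- x)"
  \<comment> \<open>Integration by parts: the constant -1 makes the boundary term vanish at
    infinity, and the sum is a primitive of \<open>1 - ?T x ^ n\<close> by the geometric
    series.\<close>
  define F where "F x = x * (?T x ^ n - 1) + (\<Sum>j<n. ?T x ^ Suc j / Suc j)" for x
  have geo: "1 - ?T x ^ n = exp (- x) * (\<Sum>j<n. ?T x ^ j)" for x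
    using one_diff_power_eq[of "?T x" n] by simp
  have dT: "DERIV (\<lambda>x. ?T x ^ Suc j / Suc j) x :> exp (- x) * ?T x ^ j" for j x
    by (auto intro!: derivative_eq_intros simp del: power_Suc of_nat_Suc)
  have "DERIV (\<lambda>x. \<Sum>j<n. ?T x ^ Suc j / Suc j) x :> (\<Sum>j<n. exp (- x) * ?T x ^ j)" for x
    by (intro DERIV_sum dT)
  then have dS: "DERIV (\<lambda>x. \<Sum>j<n. ?T x ^ Suc j / Suc j) x :> 1 - ?T x ^ n" for x
    unfolding geo sum_distrib_left .
  have dF: "DERIV F x :> exp (- x) * (n * (?T x ^ (n - 1) * x))" for x
  proof -
    have "DERIV (\<lambda>x. x * (?T x ^ n - 1)) x :> (?T x ^ n - 1) + exp (- x) * (n * (?T x ^ (n - 1) * x))"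
      by (auto intro!: derivative_eq_intros)
    from DERIV_add[OF this dS[of x]] show ?thesis unfolding F_def by simp
  qed
  \<comment> \<open>Factoring \<open>exp (- x)\<close> out of \<open>1 - ?T x ^ n\<close> exhibits
    the decay of the boundary term.\<close>
  have F_eq: "F = (\<lambda>x. - (x * exp (- x)) * (\<Sum>j<n. ?T x ^ j) + (\<Sum>j<n. ?T x ^ Suc j / Suc j))"
  proof
    fix x
    have "x * (?T x ^ n - 1) = - (x * (1 - ?T x ^ n))" by (simp add: algebra_simps)
    then show "F x = - (x * exp (- x)) * (\<Sum>j<n. ?T x ^ j) + (\<Sum>j<n. ?T x ^ Suc j / Suc j)"
      unfolding F_def geo by simp
  qed
  have l1: "((\<lambda>x::real. x * exp (- x)) \<longlongrightarrow> 0) at_top" by real_asymp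
  have l2: "(?T \<longlongrightarrow> 1) at_top" by real_asymp
  have "(F \<longlongrightarrow> - 0 * (\<Sum>j<n. 1 ^ j) + (\<Sum>j<n. 1 ^ Suc j / Suc j)) at_top"
    unfolding F_eq by (intro tendsto_intros l1 l2) auto
  moreover have "(\<Sum>j<m. 1 ^ Suc j / real (Suc j)) = harm m" for m
    by (induction m) (simp_all add: harm_Suc inverse_eq_divide harm_expand(1))
  ultimately have "(F \<longlongrightarrow> harm n) at_top" by simp
  moreover have "F 0 = 0" by (auto simp: F_def)
  ultimately have *: "integrable expX (\<lambda>x. n * (?T x ^ (n - 1) * x))"
    "(\<integral>x. n * (?T x ^ (n - 1) * x) \<partial>expX) = harm n"
    using expX_FTC[of "\<lambda>x. n * (?T x ^ (n - 1) * x)" F "harm n"] dF by auto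
  then show "integrable expX (\<lambda>x. ?T x ^ (n - 1) * x)" using n by simp
  show "(\<integral>x. ?T x ^ (n - 1) * x \<partial>expX) = harm n / n"
    using *(2)[unfolded integral_mult_right_zero] n by (subst nonzero_eq_divide_eq) (auto simp only: mult.commute of_nat_0_less_iff)
qed

text \<open>The beta integral B(n, 2) = 1/n - 1/(n+1), under the substitution u = 1 -
  e^(-x).\<close>

lemma expX_beta:
  assumes n: "0 < n"
  shows "integrable expX (\<lambda>x. (1 - exp (- x)) ^ (n - 1) * exp (- x))"
    "(\<integral>x. (1 - exp (- x)) ^ (n - 1) * exp (- x) \<partial>expX) = 1 / (real n * (real n + 1))"
proof -
  let ?T = "\<lambda>x::real. 1 - exp (- x)"
  let ?F = "\<lambda>x. ?T x ^ n / n - ?T x ^ Suc n / Suc n"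
  have l2: "(?T \<longlongrightarrow> 1) at_top" by real_asymp
  have "(?F \<longlongrightarrow> 1 ^ n / n - 1 ^ Suc n / Suc n) at_top"
    using n by (intro tendsto_intros l2) auto
  moreover have "DERIV ?F x :> exp (- x) * (?T x ^ (n - 1) * exp (- x))" for x
  proof -
    have "DERIV ?F x :> ?T x ^ (n - 1) * exp (- x) - ?T x ^ n * exp (- x)"
      using n by (auto intro!: derivative_eq_intros simp del: power_Suc of_nat_Suc)
    moreover have "?T x ^ n = ?T x ^ (n - 1) * ?T x" using n by (cases n) auto
    ultimately show ?thesis by (simp add: algebra_simps)
  qed
  moreover have "1 ^ n / n - 1 ^ Suc n / Suc n = 1 / (real n * (real n + 1))"
    using n by (simp add: field_simps)
  moreover have "?F 0 = 0" using n by simp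
  ultimately show "integrable expX (\<lambda>x. ?T x ^ (n - 1) * exp (- x))"
    "(\<integral>x. ?T x ^ (n - 1) * exp (- x) \<partial>expX) = 1 / (real n * (real n + 1))"
    using expX_FTC[of "\<lambda>x. ?T x ^ (n - 1) * exp (- x)" ?F "1 / (real n * (real n + 1))"]
    by (simp_all del: power_Suc of_nat_Suc)
qed

text \<open>The two-sided bounds on the Euler-Mascheroni constant compare \<open>harm n\<close> with
  ln (n + 1); returning to ln n costs at most 1 / n.\<close>

lemma harm_asymptotic:
  assumes "0 < n"
  shows "\<bar>harm n - (ln (real n) + euler_mascheroni)\<bar> \<le> 1 / n"
proof -
  obtain m where m: "n = Suc m" using assms gr0_conv_Suc by blast
  have "ln (1 + 1 / real n) \<le> 1 / n" by (rule ln_add_one_self_le_self) simp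
  moreover have "1 + 1 / real n = (real n + 1) / n" using assms by (simp add: field_simps)
  ultimately have l: "ln (real n + 1) - ln n \<le> 1 / n" using assms by (simp add: ln_div)
  have l0: "ln n \<le> ln (real n + 1)" using assms by simp
  have "1 / real (2 * (m + 1)) \<le> 1 / n" "0 \<le> 1 / real (2 * (m + 2))" by (auto simp: m field_simps)
  moreover have p: "real (m + 2) = real n + 1" by (simp add: m)
  ultimately show ?thesis
    using euler_mascheroni_lower[of m, unfolded p, folded m] euler_mascheroni_upper[of m, unfolded p, folded m] l l0
    by linarith
qed

text \<open>After clearing denominators the difference of the two sides is 2 (1 + x) (e^x - 1 - x -
  x^2 / 2), nonnegative by Taylor expansion. The factor e^(-x) is what brings the beta integral, of
  order 1 / n^2, into the remainder.\<close>

lemma max_remainder_bound: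
  fixes x :: real
  assumes "0 < x"
  shows "x\<^sup>2 / (exp x - (1 + x)) \<le> (2 + 2 * x + x\<^sup>2) * exp (- x)"
proof -
  have "1 + x + x\<^sup>2 / 2 \<le> exp x" using exp_lower_Taylor_quadratic[of x] assms by simp
  then have "0 \<le> (1 + x) * (2 * exp x - 2 - 2 * x - x\<^sup>2)" using assms by (intro mult_nonneg_nonneg) auto
  also have "\<dots> = (2 + 2 * x + x\<^sup>2) * (exp x - (1 + x)) - x\<^sup>2 * exp x"
    by (simp add: algebra_simps power2_eq_square)
  finally have "x\<^sup>2 * exp x \<le> (2 + 2 * x + x\<^sup>2) * (exp x - (1 + x))" by simp
  then show ?thesis
    using exp_quadratic(2)[OF assms] by (simp add: exp_minus field_simps)
qed

text \<open>Since e^x (1 - e^(-x)) = e^x - 1, the integrand under the exponential law is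
  \<open>?g1 x + ?g2 x\<close>, and \<open>?g1\<close> gives \<open>harm n / n\<close> exactly. For
  \<open>?g2\<close> the cut is at 2 ln n: the tail beyond it has probability n^(-2), and below it
  \<open>expX_beta\<close> supplies 1 / n^2 times a polynomial of size (ln n)^2. The constant 13 is
  10 + 2 from these two and 1 from \<open>harm_asymptotic\<close>; \<open>3 \<le> n\<close> ensures
  ln n \<ge> 1.\<close>

lemma max_integral_asymptotic:
  assumes n: "3 \<le> n"
  shows "\<bar>(LBINT x:{0<..}. (1 - exp (- x)) ^ n * (x / (exp x - (1 + x)))) - (ln (real n) + euler_mascheroni) / n\<bar>
     \<le> 13 * (ln (real n))\<^sup>2 / (real n)\<^sup>2"
proof -
  let ?T = "\<lambda>x::real. 1 - exp (- x)"
  let ?g1 = "\<lambda>x. ?T x ^ (n - 1) * x"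
  let ?g2 = "\<lambda>x. ?T x ^ (n - 1) * (x\<^sup>2 / (exp x - (1 + x)))"
  define l where "l = ln (real n)"
  \<comment> \<open>The polynomial of \<open>max_remainder_bound\<close> at the cut x = 2 l, its
    largest value up to there.\<close>
  define P where "P = 2 + 2 * (2 * l) + (2 * l)\<^sup>2"
  let ?E = "\<lambda>x. P * (?T x ^ (n - 1) * exp (- x)) + 2 * indicator {2 * l<..} x"
  have n0: "0 < n" using n by simp
  have "exp (1::real) \<le> n" using exp_le n by linarith
  then have l1: "1 \<le> l" using n unfolding l_def by (subst ln_ge_iff) auto
  have bound: "0 \<le> ?g2 x" "?g2 x \<le> ?E x" if x: "0 < x" for x
  proof -
    note pos = exp_quadratic[OF x]
    have T: "0 \<le> ?T x ^ (n - 1)" "?T x ^ (n - 1) \<le> 1" using x by (auto intro: power_le_one)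
    show "0 \<le> ?g2 x" using T pos by simp
    have *: "?g2 x \<le> ?T x ^ (n - 1) * ((2 + 2 * x + x\<^sup>2) * exp (- x))"
      using T by (intro mult_left_mono max_remainder_bound x)
    have P0: "0 \<le> P" using l1 by (simp add: P_def)
    show "?g2 x \<le> ?E x"
    proof (cases "x \<le> 2 * l")
      case True
      have "2 + 2 * x + x\<^sup>2 \<le> P" unfolding P_def using True x by (intro add_mono power_mono) auto
      then have "?T x ^ (n - 1) * ((2 + 2 * x + x\<^sup>2) * exp (- x)) \<le> ?T x ^ (n - 1) * (P * exp (- x))"
        using T by (intro mult_left_mono mult_right_mono) auto
      also have "\<dots> = P * (?T x ^ (n - 1) * exp (- x))" by (simp only: mult.left_commute)
      finally have "?g2 x \<le> P * (?T x ^ (n - 1) * exp (- x))" using * by (rule order_trans[rotated])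
      then show ?thesis using True by simp
    next
      case False
      have "(2 + 2 * x + x\<^sup>2) * exp (- x) \<le> (2 * exp x) * exp (- x)"
        using pos by (intro mult_right_mono) auto
      also have "\<dots> = 2" by (simp flip: exp_add)
      finally have "?T x ^ (n - 1) * ((2 + 2 * x + x\<^sup>2) * exp (- x)) \<le> 1 * 2"
        using T x by (intro mult_mono) auto
      moreover have "0 \<le> P * (?T x ^ (n - 1) * exp (- x))" using P0 T by simp
      ultimately show ?thesis using * False by (simp add: indicator_def)
    qed
  qed
  have E: "integrable expX ?E"
    using expX_beta(1)[OF n0] by (auto intro!: integrable_real_indicator simp: less_top[symmetric])
  have E_val: "(\<integral>x. ?E x \<partial>expX) \<le> 12 * l\<^sup>2 / (real n)\<^sup>2"
  proof -
    have "measure expX {2 * l<..} = exp (- (2 * l))" using l1 by (intro measure_expX_greaterThan) auto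
    also have "\<dots> = 1 / (real n)\<^sup>2"
      using n0 by (simp add: l_def exp_minus exp_double inverse_eq_divide)
    finally have "(\<integral>x. ?E x \<partial>expX) = P * (1 / (real n * (real n + 1))) + 2 * (1 / (real n)\<^sup>2)"
      using expX_beta[OF n0] by (subst Bochner_Integration.integral_add)
        (auto intro!: integrable_real_indicator simp: less_top[symmetric])
    also have "P * (1 / (real n * (real n + 1))) \<le> (10 * l\<^sup>2) * (1 / (real n)\<^sup>2)"
    proof (rule mult_mono)
      have "1 \<le> l\<^sup>2" "l \<le> l\<^sup>2" using l1 mult_mono[of 1 l 1 l] mult_mono[of 1 l l l] by (simp_all add: power2_eq_square)
      then show "P \<le> 10 * l\<^sup>2" by (simp add: P_def power2_eq_square)
      show "1 / (real n * (real n + 1)) \<le> 1 / (real n)\<^sup>2"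
        using n0 by (intro divide_left_mono) (auto simp: power2_eq_square)
    qed auto
    also have "2 * (1 / (real n)\<^sup>2) \<le> (2 * l\<^sup>2) * (1 / (real n)\<^sup>2)"
      using l1 by (intro mult_right_mono) (auto simp: one_le_power)
    finally show ?thesis by (simp add: field_simps)
  qed
  have g2: "integrable expX ?g2"
  proof (rule Bochner_Integration.integrable_bound[OF E])
    show "AE x in expX. norm (?g2 x) \<le> norm (?E x)"
      using AE_expX_pos by eventually_elim (use bound in force)
  qed measurable
  have g2_val: "0 \<le> (\<integral>x. ?g2 x \<partial>expX)" "(\<integral>x. ?g2 x \<partial>expX) \<le> 12 * l\<^sup>2 / (real n)\<^sup>2"
  proof -
    show "0 \<le> (\<integral>x. ?g2 x \<partial>expX)"
      by (rule integral_nonneg_AE) (use AE_expX_pos in eventually_elim, use bound in auto)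
    have "(\<integral>x. ?g2 x \<partial>expX) \<le> (\<integral>x. ?E x \<partial>expX)"
      by (rule integral_mono_AE[OF g2 E]) (use AE_expX_pos in eventually_elim, use bound in auto)
    then show "(\<integral>x. ?g2 x \<partial>expX) \<le> 12 * l\<^sup>2 / (real n)\<^sup>2" using E_val by linarith
  qed
  have "(LBINT x:{0<..}. ?T x ^ n * (x / (exp x - (1 + x))))
      = (\<integral>x. exp x * (?T x ^ n * (x / (exp x - (1 + x)))) \<partial>expX)"
    by (rule LBINT_eq_expX) measurable
  also have "\<dots> = (\<integral>x. ?g1 x + ?g2 x \<partial>expX)"
  proof (rule integral_cong_AE)
    show "AE x in expX. exp x * (?T x ^ n * (x / (exp x - (1 + x)))) = ?g1 x + ?g2 x"
      using AE_expX_pos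
    proof eventually_elim
      case (elim x)
      have "?T x ^ n = ?T x * ?T x ^ (n - 1)" using n0 by (cases n) auto
      moreover have "exp x * ?T x = exp x - 1" by (simp add: algebra_simps flip: exp_add)
      ultimately have "exp x * (?T x ^ n * (x / (exp x - (1 + x)))) = ?T x ^ (n - 1) * ((exp x - 1) * x / (exp x - (1 + x)))"
        by simp
      also have "(exp x - 1) * x / (exp x - (1 + x)) = x + x\<^sup>2 / (exp x - (1 + x))"
        using exp_quadratic(2)[OF elim] by (simp add: field_simps power2_eq_square)
      finally show ?case by (simp add: distrib_left)
    qed
  qed measurable
  also have "\<dots> = harm n / n + (\<integral>x. ?g2 x \<partial>expX)"
    using expX_max_mean[OF n0] g2 by simp
  finally have "\<bar>(LBINT x:{0<..}. ?T x ^ n * (x / (exp x - (1 + x)))) - harm n / n\<bar> \<le> 12 * l\<^sup>2 / (real n)\<^sup>2"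
    using g2_val by simp
  moreover have "\<bar>harm n / n - (ln (real n) + euler_mascheroni) / n\<bar> \<le> l\<^sup>2 / (real n)\<^sup>2"
  proof -
    have "\<bar>harm n / n - (ln (real n) + euler_mascheroni) / n\<bar> = \<bar>harm n - (ln (real n) + euler_mascheroni)\<bar> / n"
      by (simp add: diff_divide_distrib[symmetric] abs_divide)
    also have "\<dots> \<le> (1 / n) / n" by (intro divide_right_mono harm_asymptotic n0) simp
    also have "\<dots> \<le> l\<^sup>2 / (real n)\<^sup>2"
      using l1 n0 by (simp add: power2_eq_square divide_right_mono mult_ge1_I)
    finally show ?thesis .
  qed
  ultimately show ?thesis unfolding l_def[symmetric] by (simp add: field_simps)
qed

text \<open>For positive x, x - x^2 \<le> x / (x + 1) \<le> x, and the two gamma integrals are 1 /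
  n^2 and 2 / n^3.\<close>

lemma min_integral_asymptotic:
  assumes n: "0 < n"
  shows "\<bar>(LBINT x:{0<..}. exp (- real n * x) * (x / (x + 1))) - 1 / (real n)\<^sup>2\<bar> \<le> 2 / (real n) ^ 3"
proof -
  define a where "a = real n"
  have a: "0 < a" using n by (simp add: a_def)
  \<comment> \<open>With \<open>b\<close> for the inverse, the primitives are polynomials in
    \<open>b\<close> and \<open>x\<close> times an exponential, and their derivatives need only
    \<open>a * b = 1\<close>.\<close>
  define b where "b = 1 / a"
  have ab: "a * b = 1" and b: "0 < b" using a by (auto simp: b_def)
  have lim1: "((\<lambda>x. - (b * x + b * b) * exp (- a * x)) \<longlongrightarrow> 0) at_top" using a b by real_asymp
  have d1: "DERIV (\<lambda>x. - (b * x + b * b) * exp (- a * x)) x :> exp (- a * x) * x" for x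
    by (rule DERIV_cong, (rule derivative_eq_intros refl)+) (use ab in algebra)
  have f1: "set_integrable lborel {0<..} (\<lambda>x. exp (- a * x) * x)"
    "(LBINT x:{0<..}. exp (- a * x) * x) = 1 / a\<^sup>2"
    using half_line_FTC[OF _ d1 _ lim1] by (auto simp: b_def power2_eq_square)
  have lim2: "((\<lambda>x. - (b * (x * x) + 2 * (b * b) * x + 2 * (b * b * b)) * exp (- a * x)) \<longlongrightarrow> 0) at_top"
    using a b by real_asymp
  have d2: "DERIV (\<lambda>x. - (b * (x * x) + 2 * (b * b) * x + 2 * (b * b * b)) * exp (- a * x)) x
      :> exp (- a * x) * x\<^sup>2" for x
    by (rule DERIV_cong, (rule derivative_eq_intros refl)+) (use ab in algebra)
  have f2: "set_integrable lborel {0<..} (\<lambda>x. exp (- a * x) * x\<^sup>2)"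
    "(LBINT x:{0<..}. exp (- a * x) * x\<^sup>2) = 2 / a ^ 3"
    using half_line_FTC[OF _ d2 _ lim2] by (auto simp: b_def power3_eq_cube)
  have f: "set_integrable lborel {0<..} (\<lambda>x. exp (- a * x) * (x / (x + 1)))"
  proof (rule set_integrable_bound[OF f1(1)])
    show "AE x in lborel. x \<in> {0<..} \<longrightarrow> norm (exp (- a * x) * (x / (x + 1))) \<le> norm (exp (- a * x) * x)"
      by (auto simp: abs_mult field_simps)
  qed (auto simp: set_borel_measurable_def)
  have "(LBINT x:{0<..}. exp (- a * x) * (x / (x + 1))) \<le> (LBINT x:{0<..}. exp (- a * x) * x)"
    by (rule set_integral_mono[OF f f1(1)]) (auto simp: field_simps)
  moreover have "(LBINT x:{0<..}. exp (- a * x) * x - exp (- a * x) * x\<^sup>2) \<le> (LBINT x:{0<..}. exp (- a * x) * (x / (x + 1)))"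
  proof (rule set_integral_mono[OF _ f])
    show "set_integrable lborel {0<..} (\<lambda>x. exp (- a * x) * x - exp (- a * x) * x\<^sup>2)"
      by (rule set_integral_diff(1)[OF f1(1) f2(1)])
    fix x :: real assume "x \<in> {0<..}"
    then have "x - x\<^sup>2 \<le> x / (x + 1)" by (simp add: field_simps power2_eq_square)
    then show "exp (- a * x) * x - exp (- a * x) * x\<^sup>2 \<le> exp (- a * x) * (x / (x + 1))"
      unfolding right_diff_distrib[symmetric] by (rule mult_left_mono) simp
  qed
  moreover have "(LBINT x:{0<..}. exp (- a * x) * x - exp (- a * x) * x\<^sup>2) = 1 / a\<^sup>2 - 2 / a ^ 3"
    using set_integral_diff(2)[OF f1(1) f2(1)] f1(2) f2(2) by simp
  moreover have "0 \<le> 2 / a ^ 3" using a by simp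
  ultimately show ?thesis using f1(2) unfolding a_def[symmetric] by linarith
qed

section \<open>Eventual domination of the error terms\<close>

lemma eventually_threshold:
  fixes c :: real
  assumes "1 < c"
  shows "\<forall>\<^sub>F y in at_top. y / (exp y - 1) \<le> 1 / 2 \<and> y / (exp y - 1) \<le> exp (- y / 2) \<and> 1 / (1 - exp (- y)) \<le> c"
proof (intro eventually_conj)
  show "\<forall>\<^sub>F y::real in at_top. y / (exp y - 1) \<le> 1 / 2" by real_asymp
  show "\<forall>\<^sub>F y::real in at_top. y / (exp y - 1) \<le> exp (- y / 2)" by real_asymp
  have "((\<lambda>y::real. 1 / (1 - exp (- y))) \<longlongrightarrow> 1) at_top" by real_asymp
  then have "\<forall>\<^sub>F y::real in at_top. 1 / (1 - exp (- y)) < c" using assms by (rule order_tendstoD)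
  then show "\<forall>\<^sub>F y::real in at_top. 1 / (1 - exp (- y)) \<le> c" by eventually_elim simp
qed

text \<open>The exponent n^(1/4) / 4 is half of the n^(1/4) / 2 that e^(-Q/2) provides at the
  smallest quota; the other half absorbs polynomial factors.\<close>

lemma eventually_le_exp_root:
  fixes f :: "nat \<Rightarrow> real"
  assumes "(\<lambda>n. f n * exp (real n powr (1/4) / 4)) \<longlonglongrightarrow> 0"
  shows "\<forall>\<^sub>F n in sequentially. f n \<le> exp (- (real n powr (1/4) / 4))"
proof -
  have "\<forall>\<^sub>F n in sequentially. f n * exp (real n powr (1/4) / 4) < 1"
    using assms by (rule order_tendstoD) simp
  then show ?thesis
    by eventually_elim (simp add: exp_minus field_simps)
qed

lemma eventually_max_error:
  fixes a c k :: real
  assumes a: "0 < a" "a < 1" and k: "0 < k"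
  shows "\<forall>\<^sub>F n in sequentially. a ^ (n - 1) * (real n + c) + 4 * (real n + 8) * exp (- (real n powr (1/4)) / 2)
      + 2 * (1 + real n) * exp (- real n * k) \<le> exp (- (real n powr (1/4) / 4))"
proof (rule eventually_le_exp_root)
  define \<kappa> where "\<kappa> = - ln a"
  have \<kappa>: "0 < \<kappa>" "a = exp (- \<kappa>)" using a by (auto simp: \<kappa>_def)
  have lim: "(\<lambda>n. (exp (- \<kappa> * (real n - 1)) * (real n + c) + 4 * (real n + 8) * exp (- (real n powr (1/4)) / 2)
      + 2 * (1 + real n) * exp (- real n * k)) * exp (real n powr (1/4) / 4)) \<longlonglongrightarrow> 0"
    using \<kappa>(1) k by real_asymp
  have ev: "\<forall>\<^sub>F n in sequentially. exp (- \<kappa> * (real n - 1)) = a ^ (n - 1)"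
    using eventually_ge_at_top[of 1]
  proof eventually_elim
    case (elim n)
    have "a ^ (n - 1) = exp (real (n - 1) * - \<kappa>)" unfolding \<kappa>(2) exp_of_nat_mult ..
    then show ?case using elim by (simp add: of_nat_diff mult.commute)
  qed
  from lim show "(\<lambda>n. (a ^ (n - 1) * (real n + c) + 4 * (real n + 8) * exp (- (real n powr (1/4)) / 2)
      + 2 * (1 + real n) * exp (- real n * k)) * exp (real n powr (1/4) / 4)) \<longlonglongrightarrow> 0"
    by (rule Lim_transform_eventually) (use ev in eventually_elim, simp only:)
qed

text \<open>The term with n^(1/3) is the Chernoff error at distance n^(-1/3) from the full quota; it
  is negligible because 1/3 > 1/4.\<close>

lemma eventually_min_error:
  "\<forall>\<^sub>F n in sequentially. exp (- real (n - 1) / 2) * (real n + 1) + (real n + 1) * 2 * exp (- (real n powr (1/4)) / 2)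
      + 2 * (1 + real n) * exp (- (real n powr (1/3)) / 4) \<le> exp (- (real n powr (1/4) / 4))"
proof (rule eventually_le_exp_root)
  have lim: "(\<lambda>n. (exp (- (real n - 1) / 2) * (real n + 1) + (real n + 1) * 2 * exp (- (real n powr (1/4)) / 2)
      + 2 * (1 + real n) * exp (- (real n powr (1/3)) / 4)) * exp (real n powr (1/4) / 4)) \<longlonglongrightarrow> 0"
    by real_asymp
  have ev: "\<forall>\<^sub>F n in sequentially. real n - 1 = real (n - 1)"
    using eventually_ge_at_top[of 1] by eventually_elim (simp add: of_nat_diff)
  from lim show "(\<lambda>n. (exp (- real (n - 1) / 2) * (real n + 1) + (real n + 1) * 2 * exp (- (real n powr (1/4)) / 2)
      + 2 * (1 + real n) * exp (- (real n powr (1/3)) / 4)) * exp (real n powr (1/4) / 4)) \<longlonglongrightarrow> 0"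
    by (rule Lim_transform_eventually) (use ev in eventually_elim, simp only:)
qed

lemma quota_bounds:
  assumes n: "0 < n" and q: "real n powr (-3/4) \<le> q" "q \<le> 1 - e" and e: "0 \<le> e"
  shows "0 < q * real n" "real n powr (1/4) \<le> q * real n" "q * real n \<le> real n" "q * real n \<le> (1 - e) * real n"
    "e < 1"
proof -
  have "0 < real n powr (-3/4)" using n by simp
  then have q0: "0 < q" using q by linarith
  show "0 < q * real n" using q0 n by simp
  have "real n powr (1/4) = real n powr (-3/4) * real n powr 1" by (simp only: powr_add[symmetric]) simp
  also have "\<dots> \<le> q * real n" using q n by (auto intro!: mult_right_mono)
  finally show "real n powr (1/4) \<le> q * real n" .
  show "q * real n \<le> (1 - e) * real n" using q n by (intro mult_right_mono) auto
  also have "\<dots> \<le> real n" using e by (simp add: algebra_simps)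
  finally show "q * real n \<le> real n" .
  show "e < 1" using q0 q by linarith
qed

text \<open>\<psi>, \<open>K\<close>, \<open>C\<close> and \<open>N\<close> are fixed before
  \<open>n\<close> and \<open>q\<close>, which makes the error terms uniform; one \<open>C\<close>
  serves all four.\<close>

theorem theorem3:
  fixes \<epsilon> :: real
  assumes "\<epsilon> > 0"
  shows "\<exists>\<psi> K C. 0 < \<psi> \<and> \<psi> < 1 \<and> K > 0 \<and> (\<exists>N::nat. \<forall>n\<ge>N.
     (\<forall>q::real. real n powr (-3/4) \<le> q \<and> q \<le> 1 - \<epsilon> \<longrightarrow>
        \<bar>exp_shapley n (n - 1) (q * real n * meanX)
          - (LBINT x:{0<..}. (1 - exp (- x)) ^ n * (x / (exp x - (1 + x))))\<bar>
        \<le> C * \<psi> powr (real n powr (1/4))) \<and>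
     \<bar>(LBINT x:{0<..}. (1 - exp (- x)) ^ n * (x / (exp x - (1 + x))))
        - (ln (real n) + euler_mascheroni) / real n\<bar>
        \<le> C * (ln (real n))\<^sup>2 / (real n)\<^sup>2 \<and>
     (\<forall>q::real. real n powr (-3/4) \<le> q \<and> q \<le> 1 - K * real n powr (-1/3) \<longrightarrow>
        \<bar>exp_shapley n 0 (q * real n * meanX)
          - (LBINT x:{0<..}. exp (- real n * x) * (x / (x + 1)))\<bar>
        \<le> C * \<psi> powr (real n powr (1/4))) \<and>
     \<bar>(LBINT x:{0<..}. exp (- real n * x) * (x / (x + 1))) - 1 / (real n)\<^sup>2\<bar>
        \<le> C / (real n) ^ 3)"
proof -
  \<comment> \<open>The error bounds need \<open>e \<le> 1\<close>; for \<epsilon> > 1 the range of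
    \<open>q\<close> is empty, so replacing \<epsilon> by 1 loses nothing.\<close>
  define e where "e = min \<epsilon> 1"
  have e: "0 < e" "e \<le> 1" "1 - \<epsilon> \<le> 1 - e" using assms by (auto simp: e_def)
  \<comment> \<open>This base turns \<psi>^r into e^(-r/4), the target of
    \<open>eventually_le_exp_root\<close>.\<close>
  let ?\<psi> = "exp (- 1 / 4) :: real"
  have \<psi>: "?\<psi> powr r = exp (- (r / 4))" for r by (simp add: powr_def)
  have "1 < exp (e\<^sup>2 / 8)" using e by simp
  from eventually_threshold[OF this] obtain M1 where
    M1: "\<And>y. M1 \<le> y \<Longrightarrow> y / (exp y - 1) \<le> 1 / 2 \<and> y / (exp y - 1) \<le> exp (- y / 2)
        \<and> 1 / (1 - exp (- y)) \<le> exp (e\<^sup>2 / 8)"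
    unfolding eventually_at_top_linorder by blast
  define M\<^sub>0 where "M\<^sub>0 = max M1 1"
  have M\<^sub>0: "0 < M\<^sub>0" "\<And>y. M\<^sub>0 \<le> y \<Longrightarrow> y / (exp y - 1) \<le> 1 / 2 \<and> y / (exp y - 1) \<le> exp (- y / 2)
        \<and> 1 / (1 - exp (- y)) \<le> exp (e\<^sup>2 / 8)"
    by (simp add: M\<^sub>0_def) (rule M1, simp add: M\<^sub>0_def)
  have "\<forall>\<^sub>F n in sequentially. (1 - exp (- M\<^sub>0)) ^ (n - 1) * (real n + 2 * exp M\<^sub>0)
      + 4 * (real n + 8) * exp (- (real n powr (1/4)) / 2)
      + 2 * (1 + real n) * exp (- real n * (e\<^sup>2 / 8)) \<le> exp (- (real n powr (1/4) / 4))"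
    by (rule eventually_max_error) (use M\<^sub>0 e in auto)
  moreover note eventually_min_error eventually_ge_at_top[of "3 :: nat"]
  ultimately have "\<forall>\<^sub>F n in sequentially.
     (\<forall>q::real. real n powr (-3/4) \<le> q \<and> q \<le> 1 - \<epsilon> \<longrightarrow>
        \<bar>exp_shapley n (n - 1) (q * real n * meanX)
          - (LBINT x:{0<..}. (1 - exp (- x)) ^ n * (x / (exp x - (1 + x))))\<bar>
        \<le> 13 * ?\<psi> powr (real n powr (1/4))) \<and>
     \<bar>(LBINT x:{0<..}. (1 - exp (- x)) ^ n * (x / (exp x - (1 + x))))
        - (ln (real n) + euler_mascheroni) / real n\<bar>
        \<le> 13 * (ln (real n))\<^sup>2 / (real n)\<^sup>2 \<and>
     (\<forall>q::real. real n powr (-3/4) \<le> q \<and> q \<le> 1 - 1 * real n powr (-1/3) \<longrightarrow>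
        \<bar>exp_shapley n 0 (q * real n * meanX)
          - (LBINT x:{0<..}. exp (- real n * x) * (x / (x + 1)))\<bar>
        \<le> 13 * ?\<psi> powr (real n powr (1/4))) \<and>
     \<bar>(LBINT x:{0<..}. exp (- real n * x) * (x / (x + 1))) - 1 / (real n)\<^sup>2\<bar>
        \<le> 13 / (real n) ^ 3"
  proof eventually_elim
    case (elim n)
    let ?r = "real n powr (1/4)"
    have n: "0 < n" using elim(3) by simp
    have weaken: "x \<le> 13 * ?\<psi> powr ?r" if "x \<le> exp (- (?r / 4))" for x
      using that exp_ge_zero[of "- (?r / 4)"] unfolding \<psi> by linarith
    show ?case
    proof (intro conjI allI impI)
      fix q assume "real n powr (-3/4) \<le> q \<and> q \<le> 1 - \<epsilon>"
      then have q: "real n powr (-3/4) \<le> q" "q \<le> 1 - e" using e by auto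
      note Q = quota_bounds[OF n q less_imp_le[OF e(1)]]
      let ?Q = "q * real n"
      have "\<bar>exp_shapley n (n - 1) ?Q - (LBINT x:{0<..}. (1 - exp (- x)) ^ n * (x / (exp x - (1 + x))))\<bar>
         \<le> (1 - exp (- M\<^sub>0)) ^ (n - 1) * (real n + 2 * exp M\<^sub>0) + 4 * (real n + 8) * exp (- ?Q / 2)
           + 2 * (1 + ?Q) * exp (- real n * e\<^sup>2 / 8)"
        by (rule max_error[OF n Q(1,4) e(1,2) M\<^sub>0(2,1)])
      also have "\<dots> \<le> (1 - exp (- M\<^sub>0)) ^ (n - 1) * (real n + 2 * exp M\<^sub>0)
          + 4 * (real n + 8) * exp (- ?r / 2) + 2 * (1 + real n) * exp (- real n * (e\<^sup>2 / 8))"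
        using Q M\<^sub>0(1) by (intro add_mono mult_mono) auto
      also note elim(1)
      finally show "\<bar>exp_shapley n (n - 1) (q * real n * meanX)
          - (LBINT x:{0<..}. (1 - exp (- x)) ^ n * (x / (exp x - (1 + x))))\<bar> \<le> 13 * ?\<psi> powr ?r"
        unfolding meanX_eq_1 mult_1_right by (rule weaken)
    next
      show "\<bar>(LBINT x:{0<..}. (1 - exp (- x)) ^ n * (x / (exp x - (1 + x))))
        - (ln (real n) + euler_mascheroni) / real n\<bar> \<le> 13 * (ln (real n))\<^sup>2 / (real n)\<^sup>2"
        by (rule max_integral_asymptotic[OF elim(3)])
    next
      fix q assume q: "real n powr (-3/4) \<le> q \<and> q \<le> 1 - 1 * real n powr (-1/3)"
      \<comment> \<open>With K = 1 the gap \<open>d\<close> shrinks with n, and n d^2 = n^(1/3)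
        still outgrows n^(1/4).\<close>
      define d where "d = real n powr (-1/3)"
      have d0: "0 \<le> d" by (simp add: d_def)
      have q: "real n powr (-3/4) \<le> q" "q \<le> 1 - d" using q by (auto simp: d_def)
      note Q = quota_bounds[OF n q d0]
      let ?Q = "q * real n"
      have nd: "real n * d\<^sup>2 = real n powr (1/3)"
      proof -
        have "real n * d\<^sup>2 = real n powr 1 * (real n powr (-1/3) * real n powr (-1/3))"
          using n by (simp add: d_def power2_eq_square)
        also have "\<dots> = real n powr (1/3)" unfolding powr_add[symmetric] by simp
        finally show ?thesis .
      qed
      have "\<bar>exp_shapley n 0 ?Q - (LBINT x:{0<..}. exp (- real n * x) * (x / (x + 1)))\<bar>
         \<le> exp (- real (n - 1) / 2) * (real n + 1) + (real n + 1) * 2 * exp (- ?Q / 2)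
           + 2 * (1 + ?Q) * exp (- real n * d\<^sup>2 / 4)"
        by (rule min_error[OF n Q(1,4) d0 less_imp_le[OF Q(5)]])
      also have "\<dots> \<le> exp (- real (n - 1) / 2) * (real n + 1) + (real n + 1) * 2 * exp (- ?r / 2)
          + 2 * (1 + real n) * exp (- (real n powr (1/3)) / 4)"
        using Q by (intro add_mono mult_mono) (auto simp: nd)
      also note elim(2)
      finally show "\<bar>exp_shapley n 0 (q * real n * meanX)
          - (LBINT x:{0<..}. exp (- real n * x) * (x / (x + 1)))\<bar> \<le> 13 * ?\<psi> powr ?r"
        unfolding meanX_eq_1 mult_1_right by (rule weaken)
    next
      have "2 / (real n) ^ 3 \<le> 13 / (real n) ^ 3" by (intro divide_right_mono) auto
      with min_integral_asymptotic[OF n]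
      show "\<bar>(LBINT x:{0<..}. exp (- real n * x) * (x / (x + 1))) - 1 / (real n)\<^sup>2\<bar> \<le> 13 / (real n) ^ 3"
        by (rule order_trans)
    qed
  qed
  then obtain N where N: "\<And>n. N \<le> n \<Longrightarrow>
     (\<forall>q::real. real n powr (-3/4) \<le> q \<and> q \<le> 1 - \<epsilon> \<longrightarrow>
        \<bar>exp_shapley n (n - 1) (q * real n * meanX)
          - (LBINT x:{0<..}. (1 - exp (- x)) ^ n * (x / (exp x - (1 + x))))\<bar>
        \<le> 13 * ?\<psi> powr (real n powr (1/4))) \<and>
     \<bar>(LBINT x:{0<..}. (1 - exp (- x)) ^ n * (x / (exp x - (1 + x))))
        - (ln (real n) + euler_mascheroni) / real n\<bar>
        \<le> 13 * (ln (real n))\<^sup>2 / (real n)\<^sup>2 \<and>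
     (\<forall>q::real. real n powr (-3/4) \<le> q \<and> q \<le> 1 - 1 * real n powr (-1/3) \<longrightarrow>
        \<bar>exp_shapley n 0 (q * real n * meanX)
          - (LBINT x:{0<..}. exp (- real n * x) * (x / (x + 1)))\<bar>
        \<le> 13 * ?\<psi> powr (real n powr (1/4))) \<and>
     \<bar>(LBINT x:{0<..}. exp (- real n * x) * (x / (x + 1))) - 1 / (real n)\<^sup>2\<bar>
        \<le> 13 / (real n) ^ 3"
    unfolding eventually_sequentially by blast
  show ?thesis
    by (rule exI[of _ ?\<psi>], rule exI[of _ 1], rule exI[of _ 13], intro conjI exI[of _ N] allI impI)
       (use N in simp_all)
qed

end
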